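(* The space of orderings $(X_{\mathbb{Q}(x)}, G_{\mathbb{Q}(x)})$ of the rational function field $\mathbb{Q}(x)$ in one variable over $\mathbb{Q}$ is profinite, i.e. it is an inverse limit of finite spaces of orderings.
   Context: **Spaces of orderings (Marshall).** A space of orderings is a pair $(X,G)$ satisfying the following axioms. (AX1) $X$ is a nonempty set, and $G$ is a subgroup of $\{1,-1\}^X$ (pointwise multiplication) which contains the constant function $-1$ and separates points of $X$ (if $x\neq y$ in $X$, there is $a\in G$ with $a(x)\ne a(y)$). For $a,b\in G$ the value set is $$D_X(a,b)=\{c\in G:\ \forall x\in X\ (a(x)=c(x)\ \vee\ b(x)=c(x))\}.$$ $X$ embeds naturally in the character group $\chi(G)$ of all group homomorphisms $G\to\{-1,1\}$ by identifying $x\in X$ with the character $a\mapsto a(x)$. (AX2) If $x\in\chi(G)$ satisfies $x(-1)=-1$ and, for all $a,b\in\ker(x)$, $D_X(a,b)\subset\ker(x)$, then $x$ lies in the image of $X$ under the natural embedding. (AX3) For all $a_1,a_2,a_3\in G$, if $b\in D_X(a_1,c)$ for some $c\in D_X(a_2,a_3)$, then $b\in D_X(d,a_3)$ for some $d\in D_X(a_1,a_2)$. $(X,G)$ is called finite if $X$ is finite. **The space of orderings of a field.** For a formally real field $k$, $X_k$ is the set of all orderings of $k$, and $G_k=k^*/(\Sigma k^2)^*$ is the quotient of the multiplicative group of $k$ by the group of nonzero sums of squares. $G_k$ is identified with a subgroup of $\{-1,1\}^{X_k}$ via $a\mapsto\overline a$, where $\overline a(\sigma)=1$ if $a\in\sigma$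 and $\overline a(\sigma)=-1$ if $a\notin\sigma$, for $\sigma\in X_k$ (an ordering being identified with its set of nonnegative elements). The pair $(X_k,G_k)$ is a space of orderings. **Morphisms.** A morphism $F:(X_1,G_1)\to(X_2,G_2)$ of spaces of orderings is a function $F:X_1\to X_2$ such that $b\circ F\in G_1$ for all $b\in G_2$. An isomorphism is a bijective morphism whose inverse is also a morphism. **Inverse systems and limits.** An inverse system of spaces of orderings consists of a directed set $(I,\succeq)$, spaces of orderings $(X_i,G_i)$ for $i\in I$, and morphisms $F_{ij}:(X_i,G_i)\to(X_j,G_j)$ for $i\succeq j$, such that $F_{ii}=\mathrm{id}$, $F_{ij}(X_i)=X_j$ for all $i\succeq j$, and $F_{ik}=F_{jk}\circ F_{ij}$ for $i\succeq j\succeq k$. Surjectivity of $F_{ij}$ makes $F_{ij}^*:G_j\to G_i$, $b\mapsto b\circ F_{ij}$, injective. The inverse limit $\varprojlim(X_i,G_i)$ is $(X,G)$, where $X=\varprojlim X_i$ is the inverse limit of the sets $X_i$ along the $F_{ij}$, with projections $\pi_i:X\to X_i$, and $G=\varinjlim G_i$ is the direct limit along the $F_{ij}^*$, realized as the group of functions $a\circ\pi_i$ on $X$ with $i\in I$, $a\in G_i$. It is again a space of orderings. **Profinite.** A space of orderings is profinite if it is (up to isomorphism) the inverse limit of an inverse system of finite spaces of orderings. *)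

theory Defs
  imports
    "HOL-Algebra.Product_Groups"
    "HOL-Algebra.Sym_Groups"
    "HOL-Computational_Algebra.Polynomial"
    "HOL-Computational_Algebra.Fraction_Field"
begin

section \<open>Spaces of orderings\<close>

text \<open>
  A pair \<open>(X, G)\<close> is given by a carrier set \<open>X\<close> and a set \<open>G\<close> of functions on \<open>X\<close> with values in
  \<open>{1, -1}\<close>.  Functions on \<open>X\<close> are represented extensionally (undefined outside \<open>X\<close>), so
  that equality of elements of \<open>G\<close> is equality of functions on \<open>X\<close>.  The group \<open>{1, -1}\<close> is
  \<^const>\<open>sign_img\<close>.
\<close>

abbreviation sign_power :: "'x set \<Rightarrow> ('x \<Rightarrow> int) monoid" where
  "sign_power X \<equiv> product_group X (\<lambda>_. sign_img)"

abbreviation sign_subgroup :: "'x set \<Rightarrow> ('x \<Rightarrow> int) set \<Rightarrow> ('x \<Rightarrow> int) monoid" where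
  "sign_subgroup X G \<equiv> (sign_power X)\<lparr>carrier := G\<rparr>"

definition value_set ::
  "'x set \<Rightarrow> ('x \<Rightarrow> int) set \<Rightarrow> ('x \<Rightarrow> int) \<Rightarrow> ('x \<Rightarrow> int) \<Rightarrow> ('x \<Rightarrow> int) set" where
  "value_set X G a b = {c \<in> G. \<forall>x\<in>X. a x = c x \<or> b x = c x}"

locale space_of_orderings =
  fixes X :: "'x set" and G :: "('x \<Rightarrow> int) set"
  assumes nonempty: "X \<noteq> {}"
    and sign_subgroup: "subgroup G (sign_power X)"
    and minus_one: "(\<lambda>x\<in>X. -1) \<in> G"
    and separates: "\<And>x y. \<lbrakk>x \<in> X; y \<in> X; x \<noteq> y\<rbrakk> \<Longrightarrow> \<exists>a\<in>G. a x \<noteq> a y"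
    and characters:
      "\<And>\<chi>. \<lbrakk>\<chi> \<in> hom (sign_subgroup X G) sign_img; \<chi> (\<lambda>x\<in>X. -1) = -1;
         \<And>a b. \<lbrakk>a \<in> kernel (sign_subgroup X G) sign_img \<chi>;
                 b \<in> kernel (sign_subgroup X G) sign_img \<chi>\<rbrakk>
            \<Longrightarrow> value_set X G a b \<subseteq> kernel (sign_subgroup X G) sign_img \<chi>\<rbrakk>
       \<Longrightarrow> \<exists>x\<in>X. \<forall>a\<in>G. \<chi> a = a x"
    and associativity:
      "\<And>a\<^sub>1 a\<^sub>2 a\<^sub>3 b c. \<lbrakk>a\<^sub>1 \<in> G; a\<^sub>2 \<in> G; a\<^sub>3 \<in> G; c \<in> value_set X G a\<^sub>2 a\<^sub>3; b \<in> value_set X G a\<^sub>1 c\<rbrakk>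
       \<Longrightarrow> \<exists>d \<in> value_set X G a\<^sub>1 a\<^sub>2. b \<in> value_set X G d a\<^sub>3"

section \<open>Morphisms, inverse systems and inverse limits\<close>

definition space_morphism ::
  "'x set \<Rightarrow> ('x \<Rightarrow> int) set \<Rightarrow> 'y set \<Rightarrow> ('y \<Rightarrow> int) set \<Rightarrow> ('x \<Rightarrow> 'y) \<Rightarrow> bool" where
  "space_morphism X\<^sub>1 G\<^sub>1 X\<^sub>2 G\<^sub>2 F \<longleftrightarrow> F \<in> X\<^sub>1 \<rightarrow> X\<^sub>2 \<and> (\<forall>b\<in>G\<^sub>2. compose X\<^sub>1 b F \<in> G\<^sub>1)"

definition space_isomorphism ::
  "'x set \<Rightarrow> ('x \<Rightarrow> int) set \<Rightarrow> 'y set \<Rightarrow> ('y \<Rightarrow> int) set \<Rightarrow> ('x \<Rightarrow> 'y) \<Rightarrow> bool" where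
  "space_isomorphism X\<^sub>1 G\<^sub>1 X\<^sub>2 G\<^sub>2 F \<longleftrightarrow>
     bij_betw F X\<^sub>1 X\<^sub>2 \<and> space_morphism X\<^sub>1 G\<^sub>1 X\<^sub>2 G\<^sub>2 F \<and>
     space_morphism X\<^sub>2 G\<^sub>2 X\<^sub>1 G\<^sub>1 (inv_into X\<^sub>1 F)"

text \<open>Here \<open>ge i j\<close> is the relation \<open>i \<succeq> j\<close> of the directed index set.\<close>

locale inverse_system =
  fixes I :: "'i set" and ge :: "'i \<Rightarrow> 'i \<Rightarrow> bool"
    and X :: "'i \<Rightarrow> 'x set" and G :: "'i \<Rightarrow> ('x \<Rightarrow> int) set"
    and F :: "'i \<Rightarrow> 'i \<Rightarrow> 'x \<Rightarrow> 'x"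
  assumes index_nonempty: "I \<noteq> {}"
    and ge_refl: "\<And>i. i \<in> I \<Longrightarrow> ge i i"
    and ge_trans: "\<And>i j k. \<lbrakk>i \<in> I; j \<in> I; k \<in> I; ge i j; ge j k\<rbrakk> \<Longrightarrow> ge i k"
    and directed: "\<And>i j. \<lbrakk>i \<in> I; j \<in> I\<rbrakk> \<Longrightarrow> \<exists>k\<in>I. ge k i \<and> ge k j"
    and space: "\<And>i. i \<in> I \<Longrightarrow> space_of_orderings (X i) (G i)"
    and morphism: "\<And>i j. \<lbrakk>i \<in> I; j \<in> I; ge i j\<rbrakk> \<Longrightarrow> space_morphism (X i) (G i) (X j) (G j) (F i j)"
    and F_id: "\<And>i x. \<lbrakk>i \<in> I; x \<in> X i\<rbrakk> \<Longrightarrow> F i i x = x"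
    and F_surj: "\<And>i j. \<lbrakk>i \<in> I; j \<in> I; ge i j\<rbrakk> \<Longrightarrow> F i j ` X i = X j"
    and F_comp: "\<And>i j k x. \<lbrakk>i \<in> I; j \<in> I; k \<in> I; ge i j; ge j k; x \<in> X i\<rbrakk>
                  \<Longrightarrow> F i k x = F j k (F i j x)"

definition limit_points ::
  "'i set \<Rightarrow> ('i \<Rightarrow> 'i \<Rightarrow> bool) \<Rightarrow> ('i \<Rightarrow> 'x set) \<Rightarrow> ('i \<Rightarrow> 'i \<Rightarrow> 'x \<Rightarrow> 'x) \<Rightarrow> ('i \<Rightarrow> 'x) set" where
  "limit_points I ge X F =
     {p \<in> (\<Pi>\<^sub>E i\<in>I. X i). \<forall>i\<in>I. \<forall>j\<in>I. ge i j \<longrightarrow> F i j (p i) = p j}"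

definition limit_group ::
  "'i set \<Rightarrow> ('i \<Rightarrow> 'i \<Rightarrow> bool) \<Rightarrow> ('i \<Rightarrow> 'x set) \<Rightarrow> ('i \<Rightarrow> ('x \<Rightarrow> int) set) \<Rightarrow>
    ('i \<Rightarrow> 'i \<Rightarrow> 'x \<Rightarrow> 'x) \<Rightarrow> (('i \<Rightarrow> 'x) \<Rightarrow> int) set" where
  "limit_group I ge X G F =
     {compose (limit_points I ge X F) a (\<lambda>p. p i) | i a. i \<in> I \<and> a \<in> G i}"

text \<open>
  An existential quantifier cannot range over types, so the types of points and of indices of
  the inverse system are fixed, without loss of generality.  Every finite space is isomorphic to
  one whose points are natural numbers.  An arbitrary inverse system of finite spaces with limit
  \<open>(X, G)\<close> can be replaced by one indexed by the subgroups \<open>{a \<circ> \<pi>\<^sub>i | a \<in> G\<^sub>i}\<close> of \<open>G\<close>, ordered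
  by inclusion: the projections \<open>\<pi>\<^sub>i : X \<rightarrow> X\<^sub>i\<close> are surjective, so this subgroup determines
  \<open>(X\<^sub>i, G\<^sub>i)\<close> together with \<open>\<pi>\<^sub>i\<close> up to a unique isomorphism.
\<close>

definition profinite :: "'x set \<Rightarrow> ('x \<Rightarrow> int) set \<Rightarrow> bool" where
  "profinite X G \<longleftrightarrow>
     space_of_orderings X G \<and>
     (\<exists>(I :: ('x \<Rightarrow> int) set set) ge (Xs :: ('x \<Rightarrow> int) set \<Rightarrow> nat set) Gs F \<Phi>.
        inverse_system I ge Xs Gs F \<and> (\<forall>i\<in>I. finite (Xs i)) \<and>
        space_isomorphism X G (limit_points I ge Xs F) (limit_group I ge Xs Gs F) \<Phi>)"

section \<open>The space of orderings of a field\<close>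

text \<open>An ordering is identified with its set of nonnegative elements.\<close>

definition is_field_ordering :: "'k::field set \<Rightarrow> bool" where
  "is_field_ordering P \<longleftrightarrow>
     (\<forall>a\<in>P. \<forall>b\<in>P. a + b \<in> P) \<and> (\<forall>a\<in>P. \<forall>b\<in>P. a * b \<in> P) \<and>
     P \<union> uminus ` P = UNIV \<and> P \<inter> uminus ` P = {0}"

definition field_orderings :: "'k::field set set" where
  "field_orderings = {P. is_field_ordering P}"

definition field_units :: "'k::field monoid" where
  "field_units = \<lparr>carrier = - {0}, monoid.mult = (*), one = 1\<rparr>"

definition nonzero_sums_of_squares :: "'k::field set" where
  "nonzero_sums_of_squares = {s. s \<noteq> 0 \<and> (\<exists>xs. s = (\<Sum>x\<leftarrow>xs. x ^ 2))}"

definition sum_square_classes :: "'k::field set monoid" where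
  "sum_square_classes = field_units Mod nonzero_sums_of_squares"

text \<open>
  A class modulo nonzero sums of squares lies either inside or outside a given ordering, see
  \<open>class_sign_coset\<close> below.
\<close>

definition class_sign :: "'k::field set \<Rightarrow> 'k set \<Rightarrow> int" where
  "class_sign C = (\<lambda>P\<in>field_orderings. if C \<subseteq> P then 1 else -1)"

definition field_sign_group :: "('k::field set \<Rightarrow> int) set" where
  "field_sign_group = class_sign ` carrier sum_square_classes"

lemma field_ordering_square:
  assumes "is_field_ordering P" shows "x ^ 2 \<in> P"
proof -
  have "x \<in> P \<or> - x \<in> P"
    using assms unfolding is_field_ordering_def by (metis UNIV_I UnE add.inverse_inverse imageE)
  then have "x * x \<in> P \<or> (- x) * (- x) \<in> P"
    using assms unfolding is_field_ordering_def by blast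
  then show ?thesis by (simp add: power2_eq_square)
qed

lemma field_ordering_sum_squares:
  assumes "is_field_ordering P" shows "(\<Sum>x\<leftarrow>xs. x ^ 2) \<in> P"
proof (induction xs)
  case Nil
  then show ?case using assms by (auto simp: is_field_ordering_def)
next
  case (Cons x xs)
  then show ?case using assms field_ordering_square[OF assms, of x] by (simp add: is_field_ordering_def)
qed

lemma class_sign_coset:
  assumes "P \<in> field_orderings"
  shows "class_sign (nonzero_sums_of_squares #>\<^bsub>field_units\<^esub> a) P = (if a \<in> P then 1 else -1)"
proof -
  have P: "is_field_ordering P" using assms by (simp add: field_orderings_def)
  have one: "1 \<in> (nonzero_sums_of_squares :: 'a set)"
    unfolding nonzero_sums_of_squares_def by (auto intro!: exI[of _ "[1]"])
  have "nonzero_sums_of_squares #>\<^bsub>field_units\<^esub> a = (\<lambda>s. s * a) ` nonzero_sums_of_squares"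
    by (auto simp: r_coset_def field_units_def)
  moreover have "s * a \<in> P" if "s \<in> nonzero_sums_of_squares" "a \<in> P" for s
    using that P field_ordering_sum_squares[OF P]
    by (auto simp: nonzero_sums_of_squares_def is_field_ordering_def)
  ultimately have "nonzero_sums_of_squares #>\<^bsub>field_units\<^esub> a \<subseteq> P \<longleftrightarrow> a \<in> P"
    using one by force
  then show ?thesis using assms by (simp add: class_sign_def)
qed

lemma field_sign_group_eq:
  "field_sign_group =
     {(\<lambda>P\<in>field_orderings. if a \<in> P then 1 else -1) | a :: 'k::field. a \<noteq> 0}"
proof -
  have eq: "class_sign (nonzero_sums_of_squares #>\<^bsub>field_units\<^esub> a) =
      (\<lambda>P\<in>field_orderings. if a \<in> P then 1 else -1)" for a :: 'k
  proof
    fix P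
    show "class_sign (nonzero_sums_of_squares #>\<^bsub>field_units\<^esub> a) P =
        (\<lambda>P\<in>field_orderings. if a \<in> P then 1 else -1) P"
    proof (cases "P \<in> field_orderings")
      case True
      then show ?thesis by (simp add: class_sign_coset)
    next
      case False
      then show ?thesis by (simp add: class_sign_def)
    qed
  qed
  have "carrier (sum_square_classes :: 'k set monoid) =
      (\<lambda>a. nonzero_sums_of_squares #>\<^bsub>field_units\<^esub> a) ` (- {0})"
    unfolding sum_square_classes_def FactGroup_def RCOSETS_def
    by (auto simp: field_units_def)
  then show ?thesis
    by (auto simp: field_sign_group_def image_image eq)
qed

end

theory Submission
  imports Defs "HOL-Computational_Algebra.Field_as_Ring" "HOL-Computational_Algebra.Polynomial_Factorial"
begin

text \<open>
  The sign functions of an ordering form a group \<open>G\<close>, and it suffices to write \<open>G\<close> as a directed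
  union of finite subgroups \<open>H\<close> for which the quotient of \<open>X\<close> by \<open>H\<close> is a space of orderings.  Take a
  finite set \<open>S\<close> of prime polynomials and a finite set \<open>Q\<close> of rationals which cuts the line so finely
  that on each block (the orderings in which \<open>x\<close> has a given position relative to \<open>Q\<close>) at most
  one element of \<open>S\<close> changes sign.  Let \<open>H\<close> be generated by \<open>-1\<close>, the \<open>x - q\<close> with \<open>q \<in> Q\<close> and \<open>S\<close>.
  As the linear polynomials make all signs on the blocks independent, \<open>H\<close> is a direct product,
  indexed by \<open>S\<close>, of group extensions of spaces carrying all sign functions, for which the
  axioms can be checked by hand.
\<close>

section \<open>Spaces of orderings without separation of points\<close>

text \<open>An arbitrary finite subgroup of the sign group need not satisfy the axioms; adjoining
  enough \<open>x - q\<close> repairs this. Distinct primes are coprime, so by Bezout they are never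
  both small at the same point, and a fine rational mesh separates their sign changes. The remaining
  obstacle is that a prime with several real roots changes sign on several blocks while its exponent
  is the same on all of them. Blocks therefore cannot be treated one by one: the unit of the
  argument is the union \<open>Y i\<close> of all blocks on which one prime changes sign, and a
  witness for associativity must have a single parity throughout it. That every sign function on the
  blocks comes from G rests on the linear order of the positions relative to Q. For G itself,
  associativity involves finitely many functions and is inherited from the finite groups. The
  character axiom is not inherited in this way; it comes from the field, where the kernel of a
  suitable character, together with 0, is an ordering.\<close>

text \<open>
  The axioms of a space of orderings without separation of points.  They suffice to make the
  quotient of \<open>X\<close> by \<open>G\<close>-indistinguishability a space of orderings, so that all finite quotients
  can be studied on the same set \<open>X\<close>.
\<close>

locale sign_prespace =
  fixes X :: "'x set" and G :: "('x \<Rightarrow> int) set"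
  assumes nonempty: "X \<noteq> {}"
    and signs: "G \<subseteq> X \<rightarrow>\<^sub>E {-1, 1}"
    and mult_closed: "\<And>a b. \<lbrakk>a \<in> G; b \<in> G\<rbrakk> \<Longrightarrow> (\<lambda>x\<in>X. a x * b x) \<in> G"
    and minus_one: "(\<lambda>x\<in>X. -1) \<in> G"
    and characters:
      "\<And>\<chi>. \<lbrakk>\<chi> \<in> G \<rightarrow> {-1, 1}; \<And>a b. \<lbrakk>a \<in> G; b \<in> G\<rbrakk> \<Longrightarrow> \<chi> (\<lambda>x\<in>X. a x * b x) = \<chi> a * \<chi> b;
         \<chi> (\<lambda>x\<in>X. -1) = -1;
         \<And>a b c. \<lbrakk>a \<in> G; b \<in> G; \<chi> a = 1; \<chi> b = 1; c \<in> value_set X G a b\<rbrakk> \<Longrightarrow> \<chi> c = 1\<rbrakk>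
       \<Longrightarrow> \<exists>x\<in>X. \<forall>a\<in>G. \<chi> a = a x"
    and associativity:
      "\<And>a\<^sub>1 a\<^sub>2 a\<^sub>3 b c. \<lbrakk>a\<^sub>1 \<in> G; a\<^sub>2 \<in> G; a\<^sub>3 \<in> G; c \<in> value_set X G a\<^sub>2 a\<^sub>3; b \<in> value_set X G a\<^sub>1 c\<rbrakk>
       \<Longrightarrow> \<exists>d \<in> value_set X G a\<^sub>1 a\<^sub>2. b \<in> value_set X G d a\<^sub>3"

section \<open>Group-theoretic axioms as pointwise statements about signs\<close>

lemma sign_img_simps [simp]:
  "carrier sign_img = {-1, 1}" "x \<otimes>\<^bsub>sign_img\<^esub> y = x * y" "\<one>\<^bsub>sign_img\<^esub> = 1"
  by (simp_all add: sign_img_def)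

lemma group_sign_power: "group (sign_power X)"
  by (simp add: sign_img_is_group)

lemma hom_sign_subgroup:
  "\<chi> \<in> hom (sign_subgroup X G) sign_img \<longleftrightarrow>
     \<chi> \<in> G \<rightarrow> {-1, 1} \<and> (\<forall>a\<in>G. \<forall>b\<in>G. \<chi> (\<lambda>x\<in>X. a x * b x) = \<chi> a * \<chi> b)"
  by (auto simp: hom_def)

lemma kernel_sign_subgroup:
  "kernel (sign_subgroup X G) sign_img \<chi> = {a \<in> G. \<chi> a = 1}"
  by (auto simp: kernel_def)

lemma subgroup_sign_power:
  "subgroup G (sign_power X) \<longleftrightarrow>
     G \<noteq> {} \<and> G \<subseteq> X \<rightarrow>\<^sub>E {-1, 1} \<and> (\<forall>a\<in>G. \<forall>b\<in>G. (\<lambda>x\<in>X. a x * b x) \<in> G)"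
    (is "_ \<longleftrightarrow> ?r")
proof
  assume G: "subgroup G (sign_power X)"
  interpret group "sign_power X" by (rule group_sign_power)
  show ?r
    using subgroupE[OF G] by auto
next
  assume G: ?r
  interpret group "sign_power X" by (rule group_sign_power)
  have "inv\<^bsub>sign_power X\<^esub> a = a" if "a \<in> G" for a
  proof (rule inv_equality)
    have a: "a \<in> X \<rightarrow>\<^sub>E {-1, 1}" using G that by blast
    then show "a \<in> carrier (sign_power X)" "a \<in> carrier (sign_power X)" by simp_all
    show "a \<otimes>\<^bsub>sign_power X\<^esub> a = \<one>\<^bsub>sign_power X\<^esub>"
      using a by (auto simp: PiE_iff intro!: restrict_ext)
  qed
  then show "subgroup G (sign_power X)"
    using G by (intro subgroupI) auto
qed

lemma (in space_of_orderings) sign_prespace: "sign_prespace X G"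
proof
  have G: "G \<subseteq> X \<rightarrow>\<^sub>E {-1, 1}" "\<And>a b. \<lbrakk>a \<in> G; b \<in> G\<rbrakk> \<Longrightarrow> (\<lambda>x\<in>X. a x * b x) \<in> G"
    using sign_subgroup by (auto simp: subgroup_sign_power)
  show "X \<noteq> {}" by (rule nonempty)
  show "G \<subseteq> X \<rightarrow>\<^sub>E {-1, 1}" by (rule G)
  show "(\<lambda>x\<in>X. a x * b x) \<in> G" if "a \<in> G" "b \<in> G" for a b using that by (rule G)
  show "(\<lambda>x\<in>X. -1) \<in> G" by (rule minus_one)
  show "\<exists>x\<in>X. \<forall>a\<in>G. \<chi> a = a x"
    if "\<chi> \<in> G \<rightarrow> {-1, 1}" "\<And>a b. \<lbrakk>a \<in> G; b \<in> G\<rbrakk> \<Longrightarrow> \<chi> (\<lambda>x\<in>X. a x * b x) = \<chi> a * \<chi> b"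
      "\<chi> (\<lambda>x\<in>X. -1) = -1"
      "\<And>a b c. \<lbrakk>a \<in> G; b \<in> G; \<chi> a = 1; \<chi> b = 1; c \<in> value_set X G a b\<rbrakk> \<Longrightarrow> \<chi> c = 1" for \<chi>
  proof (rule characters)
    show "\<chi> \<in> hom (sign_subgroup X G) sign_img"
      using that(1,2) by (simp add: hom_sign_subgroup)
    show "value_set X G a b \<subseteq> kernel (sign_subgroup X G) sign_img \<chi>"
      if "a \<in> kernel (sign_subgroup X G) sign_img \<chi>" "b \<in> kernel (sign_subgroup X G) sign_img \<chi>"
      for a b
      unfolding kernel_sign_subgroup
    proof
      fix c assume c: "c \<in> value_set X G a b"
      then have "\<chi> c = 1"
        using that \<open>\<And>a b c. \<lbrakk>a \<in> G; b \<in> G; \<chi> a = 1; \<chi> b = 1; c \<in> value_set X G a b\<rbrakk> \<Longrightarrow> \<chi> c = 1\<close>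
        by (auto simp: kernel_sign_subgroup)
      then show "c \<in> {a \<in> G. \<chi> a = 1}" using c by (simp add: value_set_def)
    qed
  qed (rule that(3))
  show "\<exists>d \<in> value_set X G a\<^sub>1 a\<^sub>2. b \<in> value_set X G d a\<^sub>3"
    if "a\<^sub>1 \<in> G" "a\<^sub>2 \<in> G" "a\<^sub>3 \<in> G" "c \<in> value_set X G a\<^sub>2 a\<^sub>3" "b \<in> value_set X G a\<^sub>1 c"
    for a\<^sub>1 a\<^sub>2 a\<^sub>3 b c
    using that by (rule associativity)
qed

lemma (in sign_prespace) space_of_orderings:
  assumes separates: "\<And>x y. \<lbrakk>x \<in> X; y \<in> X; x \<noteq> y\<rbrakk> \<Longrightarrow> \<exists>a\<in>G. a x \<noteq> a y"
  shows "space_of_orderings X G"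
proof (rule space_of_orderings.intro)
  show "X \<noteq> {}" by (rule nonempty)
  show "subgroup G (sign_power X)"
    using signs mult_closed minus_one by (auto simp: subgroup_sign_power)
  show "\<exists>x\<in>X. \<forall>a\<in>G. \<chi> a = a x"
    if "\<chi> \<in> hom (sign_subgroup X G) sign_img" "\<chi> (\<lambda>x\<in>X. -1) = -1"
      and D: "\<And>a b. \<lbrakk>a \<in> kernel (sign_subgroup X G) sign_img \<chi>;
                 b \<in> kernel (sign_subgroup X G) sign_img \<chi>\<rbrakk>
            \<Longrightarrow> value_set X G a b \<subseteq> kernel (sign_subgroup X G) sign_img \<chi>" for \<chi>
  proof (rule characters)
    show "\<chi> c = 1" if "a \<in> G" "b \<in> G" "\<chi> a = 1" "\<chi> b = 1" "c \<in> value_set X G a b" for a b c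
      using D[of a b] that by (auto simp: kernel_sign_subgroup)
    show "\<chi> \<in> G \<rightarrow> {-1, 1}" "\<chi> (\<lambda>x\<in>X. -1) = -1"
      using that(1,2) by (simp_all add: hom_sign_subgroup)
    show "\<chi> (\<lambda>x\<in>X. a x * b x) = \<chi> a * \<chi> b" if "a \<in> G" "b \<in> G" for a b
      using \<open>\<chi> \<in> hom (sign_subgroup X G) sign_img\<close> that by (simp add: hom_sign_subgroup)
  qed
  show "\<exists>d \<in> value_set X G a\<^sub>1 a\<^sub>2. b \<in> value_set X G d a\<^sub>3"
    if "a\<^sub>1 \<in> G" "a\<^sub>2 \<in> G" "a\<^sub>3 \<in> G" "c \<in> value_set X G a\<^sub>2 a\<^sub>3" "b \<in> value_set X G a\<^sub>1 c"
    for a\<^sub>1 a\<^sub>2 a\<^sub>3 b c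
    using that by (rule associativity)
  show "(\<lambda>x\<in>X. -1) \<in> G" by (rule minus_one)
  show "\<exists>a\<in>G. a x \<noteq> a y" if "x \<in> X" "y \<in> X" "x \<noteq> y" for x y
    using that by (rule separates)
qed

text \<open>Associativity mentions only five functions, which lie in a common member of
  \<open>\<H>\<close>, and a value set only grows with the group. A character of the union is a
  point evaluation on each member, but the points may differ from member to member, so the character
  axiom is assumed for the union.\<close>

lemma sign_prespace_directed_Union:
  assumes nonempty: "\<H> \<noteq> {}"
    and directed: "\<And>H K. \<lbrakk>H \<in> \<H>; K \<in> \<H>\<rbrakk> \<Longrightarrow> \<exists>L\<in>\<H>. H \<union> K \<subseteq> L"
    and prespace: "\<And>H. H \<in> \<H> \<Longrightarrow> sign_prespace X H"
    and characters:
      "\<And>\<chi>. \<lbrakk>\<chi> \<in> \<Union>\<H> \<rightarrow> {-1, 1};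
         \<And>a b. \<lbrakk>a \<in> \<Union>\<H>; b \<in> \<Union>\<H>\<rbrakk> \<Longrightarrow> \<chi> (\<lambda>x\<in>X. a x * b x) = \<chi> a * \<chi> b;
         \<chi> (\<lambda>x\<in>X. -1) = -1;
         \<And>a b c. \<lbrakk>a \<in> \<Union>\<H>; b \<in> \<Union>\<H>; \<chi> a = 1; \<chi> b = 1; c \<in> value_set X (\<Union>\<H>) a b\<rbrakk> \<Longrightarrow> \<chi> c = 1\<rbrakk>
       \<Longrightarrow> \<exists>x\<in>X. \<forall>a\<in>\<Union>\<H>. \<chi> a = a x"
  shows "sign_prespace X (\<Union>\<H>)"
proof (rule sign_prespace.intro)
  obtain H where H: "H \<in> \<H>" using nonempty by blast
  interpret H: sign_prespace X H by (rule prespace[OF H])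
  show "X \<noteq> {}" by (rule H.nonempty)
  show "(\<lambda>x\<in>X. -1) \<in> \<Union>\<H>" using H H.minus_one by blast
  show "\<Union>\<H> \<subseteq> X \<rightarrow>\<^sub>E {-1, 1}" using sign_prespace.signs[OF prespace] by blast
  have common: "\<exists>H\<in>\<H>. A \<subseteq> H" if "finite A" "A \<subseteq> \<Union>\<H>" for A
    using that
  proof (induction A)
    case empty
    then show ?case using H by blast
  next
    case (insert a A)
    then obtain K L where KL: "K \<in> \<H>" "A \<subseteq> K" "L \<in> \<H>" "a \<in> L" by auto
    then show ?case using directed[OF KL(1,3)] by blast
  qed
  show "(\<lambda>x\<in>X. a x * b x) \<in> \<Union>\<H>" if "a \<in> \<Union>\<H>" "b \<in> \<Union>\<H>" for a b
  proof -
    have "\<exists>K\<in>\<H>. {a, b} \<subseteq> K" using that by (intro common) simp_all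
    then obtain K where "K \<in> \<H>" "a \<in> K" "b \<in> K" by auto
    then show ?thesis using sign_prespace.mult_closed[OF prespace, of K a b] by blast
  qed
  show "\<exists>d \<in> value_set X (\<Union>\<H>) a\<^sub>1 a\<^sub>2. b \<in> value_set X (\<Union>\<H>) d a\<^sub>3"
    if a: "a\<^sub>1 \<in> \<Union>\<H>" "a\<^sub>2 \<in> \<Union>\<H>" "a\<^sub>3 \<in> \<Union>\<H>"
      and c: "c \<in> value_set X (\<Union>\<H>) a\<^sub>2 a\<^sub>3" and b: "b \<in> value_set X (\<Union>\<H>) a\<^sub>1 c"
    for a\<^sub>1 a\<^sub>2 a\<^sub>3 b c
  proof -
    have "{a\<^sub>1, a\<^sub>2, a\<^sub>3, b, c} \<subseteq> \<Union>\<H>" using a b c by (simp add: value_set_def)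
    then have "\<exists>K\<in>\<H>. {a\<^sub>1, a\<^sub>2, a\<^sub>3, b, c} \<subseteq> K" by (intro common) simp_all
    then obtain K where K: "K \<in> \<H>" "a\<^sub>1 \<in> K" "a\<^sub>2 \<in> K" "a\<^sub>3 \<in> K" "b \<in> K" "c \<in> K" by auto
    have "c \<in> value_set X K a\<^sub>2 a\<^sub>3" "b \<in> value_set X K a\<^sub>1 c"
      using b c K by (simp_all add: value_set_def)
    then obtain d where "d \<in> value_set X K a\<^sub>1 a\<^sub>2" "b \<in> value_set X K d a\<^sub>3"
      using sign_prespace.associativity[OF prespace[OF K(1)] K(2-4)] by blast
    then show ?thesis using K(1) by (auto simp: value_set_def)
  qed
qed (rule characters; assumption)

section \<open>Finite quotients and profiniteness\<close>

text \<open>A model of the quotient of X by the fibres of \<open>\<pi>\<close>. Pullback along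
  \<open>\<pi>\<close> identifies these functions with the sign functions in H that are constant on
  fibres.\<close>

definition push_group :: "'x set \<Rightarrow> ('x \<Rightarrow> int) set \<Rightarrow> ('x \<Rightarrow> 'y) \<Rightarrow> ('y \<Rightarrow> int) set" where
  "push_group X H \<pi> = {g \<in> \<pi> ` X \<rightarrow>\<^sub>E {-1, 1}. compose X g \<pi> \<in> H}"

lemma (in sign_prespace) push_group_surj:
  assumes \<pi>: "\<And>x y a. \<lbrakk>x \<in> X; y \<in> X; \<pi> x = \<pi> y; a \<in> G\<rbrakk> \<Longrightarrow> a x = a y" and a: "a \<in> G"
  shows "\<exists>g\<in>push_group X G \<pi>. compose X g \<pi> = a"
proof -
  define g where "g = (\<lambda>n\<in>\<pi> ` X. a (inv_into X \<pi> n))"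
  have g: "g (\<pi> x) = a x" if "x \<in> X" for x
    using \<pi>[of "inv_into X \<pi> (\<pi> x)" x a] that a by (auto simp: g_def inv_into_into f_inv_into_f)
  have aX: "a \<in> X \<rightarrow>\<^sub>E {-1, 1}" using a signs by blast
  have c: "compose X g \<pi> = a"
    using g aX by (auto simp: compose_def PiE_iff extensional_def)
  have "g (\<pi> x) \<in> {-1, 1}" if "x \<in> X" for x using aX g[OF that] that by (auto simp: PiE_iff)
  moreover have "g \<in> extensional (\<pi> ` X)" by (simp add: g_def)
  ultimately have "g \<in> \<pi> ` X \<rightarrow>\<^sub>E {-1, 1}" by (auto simp: PiE_iff)
  then show ?thesis using c a by (auto simp: push_group_def)
qed

lemma push_group_eqI:
  assumes "g \<in> push_group X G \<pi>" "h \<in> push_group X G \<pi>" "compose X g \<pi> = compose X h \<pi>"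
  shows "g = h"
proof (rule PiE_ext)
  show "g \<in> \<pi> ` X \<rightarrow>\<^sub>E {-1, 1}" "h \<in> \<pi> ` X \<rightarrow>\<^sub>E {-1, 1}" using assms by (auto simp: push_group_def)
  show "g n = h n" if "n \<in> \<pi> ` X" for n
    using that assms(3) by (auto simp: compose_eq) (metis compose_eq)
qed

lemma value_set_push_group:
  assumes "c \<in> push_group X G \<pi>"
  shows "c \<in> value_set (\<pi> ` X) (push_group X G \<pi>) a b \<longleftrightarrow>
    compose X c \<pi> \<in> value_set X G (compose X a \<pi>) (compose X b \<pi>)"
  using assms by (auto simp: value_set_def push_group_def compose_eq)

text \<open>The fibres of \<open>\<pi>\<close> are the classes of points that G cannot distinguish,
  so pullback is a bijection from the pushed group onto G. It respects products and value sets,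
  hence the axioms transfer, and points are now separated.\<close>

lemma (in sign_prespace) space_of_orderings_push_group:
  assumes \<pi>: "\<And>x y. \<lbrakk>x \<in> X; y \<in> X\<rbrakk> \<Longrightarrow> \<pi> x = \<pi> y \<longleftrightarrow> (\<forall>a\<in>G. a x = a y)"
  shows "space_of_orderings (\<pi> ` X) (push_group X G \<pi>)"
proof -
  let ?G = "push_group X G \<pi>"
  let ?p = "\<lambda>g. compose X g \<pi>"
  have surj: "\<exists>g\<in>?G. ?p g = a" if "a \<in> G" for a
  proof (rule push_group_surj)
    show "b x = b y" if "x \<in> X" "y \<in> X" "\<pi> x = \<pi> y" "b \<in> G" for x y b
      using \<pi>[of x y] that by simp
  qed (rule that)
  have pG: "?p g \<in> G" if "g \<in> ?G" for g using that by (simp add: push_group_def)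
  \<comment> \<open>A section of pullback; injectivity makes it the inverse, so a character
    \<open>\<chi>\<close> of the quotient group becomes the character
    \<open>\<chi> \<circ> l\<close> of G.\<close>
  obtain l where l: "l a \<in> ?G" "?p (l a) = a" if "a \<in> G" for a
    using surj by metis
  have lp: "l (?p g) = g" if "g \<in> ?G" for g
    using push_group_eqI[OF l(1)[OF pG[OF that]] that l(2)[OF pG[OF that]]] .
  have p_mult: "?p (\<lambda>x\<in>\<pi> ` X. a x * b x) = (\<lambda>x\<in>X. ?p a x * ?p b x)" for a b
    by (auto simp: compose_def)
  have G_mult: "(\<lambda>x\<in>\<pi> ` X. a x * b x) \<in> ?G" if "a \<in> ?G" "b \<in> ?G" for a b
  proof -
    have "a (\<pi> x) * b (\<pi> x) \<in> {-1, 1}" if "x \<in> X" for x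
    proof -
      have "a (\<pi> x) \<in> {-1, 1}" "b (\<pi> x) \<in> {-1, 1}"
        using that \<open>a \<in> ?G\<close> \<open>b \<in> ?G\<close> by (auto simp: push_group_def PiE_iff)
      then show ?thesis by auto
    qed
    then show ?thesis
      using mult_closed[OF pG pG, OF that] unfolding p_mult[symmetric] by (auto simp: push_group_def PiE_iff)
  qed
  have p_minus: "?p (\<lambda>x\<in>\<pi> ` X. -1 :: int) = (\<lambda>x\<in>X. -1)" by (auto simp: compose_def)
  interpret P: sign_prespace "\<pi> ` X" ?G
  proof
    show "\<pi> ` X \<noteq> {}" using nonempty by simp
    show "?G \<subseteq> \<pi> ` X \<rightarrow>\<^sub>E {-1, 1}" by (auto simp: push_group_def)
    show "(\<lambda>x\<in>\<pi> ` X. a x * b x) \<in> ?G" if "a \<in> ?G" "b \<in> ?G" for a b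
      using that by (rule G_mult)
    show minus: "(\<lambda>x\<in>\<pi> ` X. -1) \<in> ?G"
      using minus_one p_minus by (auto simp: push_group_def)
    show "\<exists>x\<in>\<pi> ` X. \<forall>a\<in>?G. \<chi> a = a x"
      if sgn: "\<chi> \<in> ?G \<rightarrow> {-1, 1}"
        and mult: "\<And>a b. \<lbrakk>a \<in> ?G; b \<in> ?G\<rbrakk> \<Longrightarrow> \<chi> (\<lambda>x\<in>\<pi> ` X. a x * b x) = \<chi> a * \<chi> b"
        and neg: "\<chi> (\<lambda>x\<in>\<pi> ` X. -1) = -1"
        and D: "\<And>a b c. \<lbrakk>a \<in> ?G; b \<in> ?G; \<chi> a = 1; \<chi> b = 1; c \<in> value_set (\<pi> ` X) ?G a b\<rbrakk> \<Longrightarrow> \<chi> c = 1"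
      for \<chi>
    proof -
      have "\<exists>x\<in>X. \<forall>a\<in>G. (\<chi> \<circ> l) a = a x"
      proof (rule characters)
        show "\<chi> \<circ> l \<in> G \<rightarrow> {-1, 1}" using sgn l by auto
        show "(\<chi> \<circ> l) (\<lambda>x\<in>X. -1) = -1"
          using lp[OF minus] neg by (simp add: p_minus)
        show "(\<chi> \<circ> l) (\<lambda>x\<in>X. a x * b x) = (\<chi> \<circ> l) a * (\<chi> \<circ> l) b" if "a \<in> G" "b \<in> G" for a b
        proof -
          have "l (\<lambda>x\<in>X. a x * b x) = (\<lambda>x\<in>\<pi> ` X. l a x * l b x)"
            using lp[OF G_mult[OF l(1) l(1), OF that]] p_mult[of "l a" "l b"] l that by simp
          then show ?thesis using mult l that by simp
        qed
        show "(\<chi> \<circ> l) c = 1"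
          if "a \<in> G" "b \<in> G" "(\<chi> \<circ> l) a = 1" "(\<chi> \<circ> l) b = 1" "c \<in> value_set X G a b" for a b c
        proof -
          have "c \<in> G" using that by (simp add: value_set_def)
          then show ?thesis
            using D[of "l a" "l b" "l c"] that l by (simp add: value_set_push_group)
        qed
      qed
      then obtain x where x: "x \<in> X" "\<And>a. a \<in> G \<Longrightarrow> \<chi> (l a) = a x" by auto
      have "\<chi> g = g (\<pi> x)" if "g \<in> ?G" for g
        using x(2)[OF pG[OF that]] lp[OF that] x(1) by (simp add: compose_eq)
      then show ?thesis using x(1) by blast
    qed
    show "\<exists>d \<in> value_set (\<pi> ` X) ?G a\<^sub>1 a\<^sub>2. b \<in> value_set (\<pi> ` X) ?G d a\<^sub>3"
      if "a\<^sub>1 \<in> ?G" "a\<^sub>2 \<in> ?G" "a\<^sub>3 \<in> ?G" "c \<in> value_set (\<pi> ` X) ?G a\<^sub>2 a\<^sub>3"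
        "b \<in> value_set (\<pi> ` X) ?G a\<^sub>1 c" for a\<^sub>1 a\<^sub>2 a\<^sub>3 b c
    proof -
      have bc: "b \<in> ?G" "c \<in> ?G" using that by (auto simp: value_set_def)
      then have "\<exists>d \<in> value_set X G (?p a\<^sub>1) (?p a\<^sub>2). ?p b \<in> value_set X G d (?p a\<^sub>3)"
        using that pG by (intro associativity[of _ _ _ "?p c"]) (simp_all add: value_set_push_group)
      then obtain d where d: "d \<in> value_set X G (?p a\<^sub>1) (?p a\<^sub>2)" "?p b \<in> value_set X G d (?p a\<^sub>3)"
        by blast
      then have "d \<in> G" by (simp add: value_set_def)
      then show ?thesis
        using d l bc by (intro bexI[of _ "l d"]) (simp_all add: value_set_push_group)
    qed
  qed
  show ?thesis
  proof (rule P.space_of_orderings)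
    fix x y assume "x \<in> \<pi> ` X" "y \<in> \<pi> ` X" "x \<noteq> y"
    then obtain x' y' where xy: "x' \<in> X" "y' \<in> X" "x = \<pi> x'" "y = \<pi> y'" by blast
    then obtain a where a: "a \<in> G" "a x' \<noteq> a y'" using \<pi>[of x' y'] \<open>x \<noteq> y\<close> by auto
    then have "l a x \<noteq> l a y" using l(2)[OF a(1)] xy by (metis compose_eq)
    then show "\<exists>a\<in>?G. a x \<noteq> a y" using l(1)[OF a(1)] by blast
  qed
qed

text \<open>A point is encoded by its vector of signs on H. There are finitely many such vectors,
  and numbering them yields the points of type \<open>nat\<close> that the definition of
  \<open>profinite\<close> asks for.\<close>

lemma finite_separating_map:
  assumes "finite H" "\<And>a x. \<lbrakk>a \<in> H; x \<in> X\<rbrakk> \<Longrightarrow> a x \<in> ({-1, 1} :: int set)"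
  obtains \<pi> :: "'x \<Rightarrow> nat" where "\<And>x y. \<lbrakk>x \<in> X; y \<in> X\<rbrakk> \<Longrightarrow> \<pi> x = \<pi> y \<longleftrightarrow> (\<forall>a\<in>H. a x = a y)"
    "finite (\<pi> ` X)"
proof -
  define r where "r x = (\<lambda>a\<in>H. a x)" for x :: 'x
  have "r x \<in> H \<rightarrow>\<^sub>E {-1, 1}" if x: "x \<in> X" for x
  proof (rule PiE_I)
    show "r x a \<in> {-1, 1}" if "a \<in> H" for a using assms(2)[OF that x] that by (simp add: r_def)
  qed (simp add: r_def)
  then have "r ` X \<subseteq> H \<rightarrow>\<^sub>E {-1, 1}" by blast
  then have fin: "finite (r ` X)"
    using assms(1) by (meson finite.emptyI finite.insertI finite_PiE finite_subset)
  then obtain e :: "_ \<Rightarrow> nat" where e: "inj_on e (r ` X)"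
    using finite_imp_inj_to_nat_seg[OF fin] by auto
  show ?thesis
  proof
    show "(e \<circ> r) x = (e \<circ> r) y \<longleftrightarrow> (\<forall>a\<in>H. a x = a y)" if "x \<in> X" "y \<in> X" for x y
    proof -
      have "(e \<circ> r) x = (e \<circ> r) y \<longleftrightarrow> r x = r y" using e that by (auto simp: inj_on_def)
      also have "\<dots> \<longleftrightarrow> (\<forall>a\<in>H. a x = a y)"
        by (auto simp: r_def fun_eq_iff restrict_def)
      finally show ?thesis .
    qed
    show "finite ((e \<circ> r) ` X)" using finite_imageI[OF fin, of e] by (simp add: image_comp)
  qed
qed

text \<open>The inverse system is indexed by \<open>\<H>\<close> under inclusion, with the quotient
  of X by H at the index H. The map into the limit is injective because G separates points, and
  surjective by the character axiom, which takes the place of compactness of X.\<close>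

theorem (in space_of_orderings) profiniteI:
  assumes union: "\<Union>\<H> = G"
    and directed: "\<And>H K. \<lbrakk>H \<in> \<H>; K \<in> \<H>\<rbrakk> \<Longrightarrow> \<exists>L\<in>\<H>. H \<union> K \<subseteq> L"
    and finite: "\<And>H. H \<in> \<H> \<Longrightarrow> finite H"
    and prespace: "\<And>H. H \<in> \<H> \<Longrightarrow> sign_prespace X H"
  shows "profinite X G"
proof -
  have signs: "a x \<in> {-1, 1}" if "a \<in> G" "x \<in> X" for a x
    using sign_prespace.signs[OF sign_prespace] that by (auto simp: PiE_iff)
  have "\<exists>\<pi> :: 'x \<Rightarrow> nat. (\<forall>x\<in>X. \<forall>y\<in>X. \<pi> x = \<pi> y \<longleftrightarrow> (\<forall>a\<in>H. a x = a y)) \<and> finite (\<pi> ` X)"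
    if "H \<in> \<H>" for H
  proof -
    have "a x \<in> {-1, 1}" if "a \<in> H" "x \<in> X" for a x
      using that \<open>H \<in> \<H>\<close> union signs by blast
    then show ?thesis by (rule finite_separating_map[OF finite[OF that]]) blast+
  qed
  then obtain \<pi> :: "('x \<Rightarrow> int) set \<Rightarrow> 'x \<Rightarrow> nat"
    where \<pi>: "\<And>H x y. \<lbrakk>H \<in> \<H>; x \<in> X; y \<in> X\<rbrakk> \<Longrightarrow> \<pi> H x = \<pi> H y \<longleftrightarrow> (\<forall>a\<in>H. a x = a y)"
      and fin: "\<And>H. H \<in> \<H> \<Longrightarrow> finite (\<pi> H ` X)"
    by metis
  define ge :: "('x \<Rightarrow> int) set \<Rightarrow> ('x \<Rightarrow> int) set \<Rightarrow> bool" where "ge H K \<longleftrightarrow> K \<subseteq> H" for H K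
  define Xs where "Xs H = \<pi> H ` X" for H
  define Gs where "Gs H = push_group X H (\<pi> H)" for H
  \<comment> \<open>Any preimage in X will do: for K \<subseteq> H, points that H cannot distinguish
    are not distinguished by K either.\<close>
  define F where "F H K n = \<pi> K (inv_into X (\<pi> H) n)" for H K n
  have F: "F H K (\<pi> H x) = \<pi> K x" if "H \<in> \<H>" "K \<in> \<H>" "ge H K" "x \<in> X" for H K x
  proof -
    let ?y = "inv_into X (\<pi> H) (\<pi> H x)"
    have y: "?y \<in> X" "\<pi> H ?y = \<pi> H x" using that by (auto simp: inv_into_into f_inv_into_f)
    then show ?thesis using \<pi>[of H ?y x] \<pi>[of K ?y x] that by (auto simp: F_def ge_def)
  qed
  have surj: "\<exists>g\<in>Gs H. compose X g (\<pi> H) = a" if "H \<in> \<H>" "a \<in> H" for a H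
    unfolding Gs_def
  proof (rule sign_prespace.push_group_surj[OF prespace])
    show "b x = b y" if "x \<in> X" "y \<in> X" "\<pi> H x = \<pi> H y" "b \<in> H" for x y b
      using \<pi>[OF \<open>H \<in> \<H>\<close> that(1,2)] that by simp
  qed (rule that)+
  have GsH: "compose X g (\<pi> H) \<in> H" if "g \<in> Gs H" for g H using that by (simp add: Gs_def push_group_def)
  have sys: "inverse_system \<H> ge Xs Gs F"
  proof (rule inverse_system.intro)
    show "\<H> \<noteq> {}" using union minus_one by blast
    show "\<exists>k\<in>\<H>. ge k i \<and> ge k j" if "i \<in> \<H>" "j \<in> \<H>" for i j
      using directed[OF that] by (auto simp: ge_def)
    show "space_of_orderings (Xs H) (Gs H)" if "H \<in> \<H>" for H
      unfolding Xs_def Gs_def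
      by (rule sign_prespace.space_of_orderings_push_group[OF prespace[OF that] \<pi>[OF that]])
    show "space_morphism (Xs H) (Gs H) (Xs K) (Gs K) (F H K)" if HK: "H \<in> \<H>" "K \<in> \<H>" "ge H K" for H K
      unfolding space_morphism_def
    proof
      show "F H K \<in> Xs H \<rightarrow> Xs K" using F[OF HK] by (auto simp: Xs_def)
      show "\<forall>b\<in>Gs K. compose (Xs H) b (F H K) \<in> Gs H"
      proof
        fix b assume b: "b \<in> Gs K"
        have "compose X (compose (Xs H) b (F H K)) (\<pi> H) = compose X b (\<pi> K)"
          using F[OF HK] by (auto simp: compose_def Xs_def)
        moreover have "compose X b (\<pi> K) \<in> H" using GsH[OF b] HK by (auto simp: ge_def)
        moreover have "b (\<pi> K x) \<in> {-1, 1}" if "x \<in> X" for x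
          using b that by (auto simp: Gs_def push_group_def PiE_iff)
        ultimately show "compose (Xs H) b (F H K) \<in> Gs H"
          using F[OF HK] by (auto simp: Gs_def push_group_def PiE_iff Xs_def compose_eq)
      qed
    qed
    show "F H H x = x" if "H \<in> \<H>" "x \<in> Xs H" for H x
      using that F[of H H] by (auto simp: Xs_def ge_def)
    show "F H K ` Xs H = Xs K" if "H \<in> \<H>" "K \<in> \<H>" "ge H K" for H K
      using F[OF that] by (force simp: Xs_def image_image)
    show "F H L x = F K L (F H K x)"
      if "H \<in> \<H>" "K \<in> \<H>" "L \<in> \<H>" "ge H K" "ge K L" "x \<in> Xs H" for H K L x
    proof -
      have "ge H L" using that by (auto simp: ge_def)
      then show ?thesis using that F by (auto simp: Xs_def)
    qed
  qed (auto simp: ge_def)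
  let ?L = "limit_points \<H> ge Xs F"
  define \<Phi> where "\<Phi> x = (\<lambda>H\<in>\<H>. \<pi> H x)" for x
  have \<Phi>_in: "\<Phi> x \<in> ?L" if "x \<in> X" for x
    using that F by (auto simp: \<Phi>_def limit_points_def Xs_def)
  have inj: "inj_on \<Phi> X"
  proof (rule inj_onI, rule ccontr)
    fix x y assume xy: "x \<in> X" "y \<in> X" "\<Phi> x = \<Phi> y" "x \<noteq> y"
    obtain a where "a \<in> G" "a x \<noteq> a y" using separates xy by blast
    then obtain H where H: "H \<in> \<H>" "a \<in> H" using union by blast
    then have "\<pi> H x = \<pi> H y" using fun_cong[OF xy(3), of H] by (simp add: \<Phi>_def)
    then show False using \<pi> H xy \<open>a x \<noteq> a y\<close> by blast
  qed
  have surj_\<Phi>: "\<exists>x\<in>X. p = \<Phi> x" if p: "p \<in> ?L" for p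
  proof -
    have "\<exists>x\<in>X. p H = \<pi> H x" if "H \<in> \<H>" for H
      using p that by (auto simp: limit_points_def Xs_def PiE_iff)
    then obtain z where z: "\<And>H. H \<in> \<H> \<Longrightarrow> z H \<in> X \<and> p H = \<pi> H (z H)" by metis
    have z_eq: "a (z H) = a (z K)" if "H \<in> \<H>" "K \<in> \<H>" "a \<in> K" "ge H K" for H K a
    proof -
      have "\<pi> K (z H) = F H K (p H)" using F[of H K "z H"] that z by auto
      also have "\<dots> = \<pi> K (z K)" using p that z by (auto simp: limit_points_def)
      finally show ?thesis using \<pi>[of K "z H" "z K"] that z by blast
    qed
    \<comment> \<open>A point of the limit is a compatible family of points \<open>z H\<close>, which glue to a character of \<open>G\<close>.\<close>
    define \<chi> where "\<chi> a = a (z (SOME H. H \<in> \<H> \<and> a \<in> H))" for a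
    have \<chi>: "\<chi> a = a (z H)" if H: "H \<in> \<H>" "a \<in> H" for a H
    proof -
      let ?K = "SOME H. H \<in> \<H> \<and> a \<in> H"
      have K: "?K \<in> \<H>" "a \<in> ?K" using someI[of "\<lambda>H. H \<in> \<H> \<and> a \<in> H", OF conjI, OF H] by auto
      obtain L where L: "L \<in> \<H>" "ge L H" "ge L ?K" using directed[OF H(1) K(1)] by (auto simp: ge_def)
      have "a (z ?K) = a (z L)" using z_eq[OF L(1) K L(3)] by simp
      also have "\<dots> = a (z H)" using z_eq[OF L(1) H L(2)] by simp
      finally show ?thesis by (simp add: \<chi>_def)
    qed
    have common: "\<exists>H\<in>\<H>. a \<in> H \<and> b \<in> H \<and> c \<in> H" if abc: "a \<in> G" "b \<in> G" "c \<in> G" for a b c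
    proof -
      obtain A B C where ABC: "A \<in> \<H>" "a \<in> A" "B \<in> \<H>" "b \<in> B" "C \<in> \<H>" "c \<in> C"
        using union abc by blast
      obtain D where "D \<in> \<H>" "A \<union> B \<subseteq> D" using directed[of A B] ABC by blast
      then obtain E where "E \<in> \<H>" "D \<union> C \<subseteq> E" using directed[of D C] ABC by blast
      then show ?thesis using ABC \<open>A \<union> B \<subseteq> D\<close> by blast
    qed
    have mult: "(\<lambda>x\<in>X. a x * b x) \<in> G" if "a \<in> G" "b \<in> G" for a b
      using sign_prespace.mult_closed[OF sign_prespace that] .
    have "\<exists>x\<in>X. \<forall>a\<in>G. \<chi> a = a x"
    proof (rule sign_prespace.characters[OF sign_prespace])
      show "\<chi> \<in> G \<rightarrow> {-1, 1}"
      proof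
        fix a assume a: "a \<in> G"
        then obtain H where "H \<in> \<H>" "a \<in> H" using union by blast
        then show "\<chi> a \<in> {-1, 1}" using \<chi> z signs[OF a] by simp
      qed
      show "\<chi> (\<lambda>x\<in>X. - 1) = - 1"
      proof -
        obtain H where "H \<in> \<H>" "(\<lambda>x\<in>X. - 1) \<in> H" using union minus_one by blast
        then show ?thesis using \<chi> z by simp
      qed
      show "\<chi> (\<lambda>x\<in>X. a x * b x) = \<chi> a * \<chi> b" if "a \<in> G" "b \<in> G" for a b
      proof -
        have "(\<lambda>x\<in>X. a x * b x) \<in> G" using mult that by blast
        then obtain H where "H \<in> \<H>" "a \<in> H" "b \<in> H" "(\<lambda>x\<in>X. a x * b x) \<in> H"
          using common[OF \<open>a \<in> G\<close> \<open>b \<in> G\<close>] by blast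
        then show ?thesis using \<chi> z by simp
      qed
      show "\<chi> c = 1" if "a \<in> G" "b \<in> G" "\<chi> a = 1" "\<chi> b = 1" "c \<in> value_set X G a b" for a b c
      proof -
        have "c \<in> G" using that by (simp add: value_set_def)
        then obtain H where H: "H \<in> \<H>" "a \<in> H" "b \<in> H" "c \<in> H"
          using common[OF \<open>a \<in> G\<close> \<open>b \<in> G\<close>] by blast
        then show ?thesis using \<chi>[OF H(1)] z[OF H(1)] that by (auto simp: value_set_def)
      qed
    qed
    then obtain x where x: "x \<in> X" "\<And>a. a \<in> G \<Longrightarrow> \<chi> a = a x" by blast
    have "p H = \<pi> H x" if "H \<in> \<H>" for H
    proof -
      have "a (z H) = a x" if "a \<in> H" for a
        using x(2)[of a] \<chi>[OF \<open>H \<in> \<H>\<close> that] union \<open>H \<in> \<H>\<close> that by auto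
      then show ?thesis using \<pi>[of H "z H" x] z that x(1) by simp
    qed
    moreover have "p \<in> extensional \<H>" using p by (auto simp: limit_points_def PiE_iff)
    ultimately have "p = \<Phi> x"
      by (intro extensionalityI[of _ \<H>]) (auto simp: \<Phi>_def)
    then show ?thesis using x(1) by blast
  qed
  have "space_isomorphism X G ?L (limit_group \<H> ge Xs Gs F) \<Phi>"
    unfolding space_isomorphism_def
  proof (intro conjI)
    show bij: "bij_betw \<Phi> X ?L"
      using inj \<Phi>_in surj_\<Phi> by (auto simp: bij_betw_def)
    show "space_morphism X G ?L (limit_group \<H> ge Xs Gs F) \<Phi>"
      unfolding space_morphism_def
    proof (intro conjI ballI)
      show "\<Phi> \<in> X \<rightarrow> ?L" using \<Phi>_in by blast
      fix b assume "b \<in> limit_group \<H> ge Xs Gs F"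
      then obtain H a where H: "H \<in> \<H>" "a \<in> Gs H" "b = compose ?L a (\<lambda>p. p H)"
        by (auto simp: limit_group_def)
      then have "compose X b \<Phi> = compose X a (\<pi> H)"
        using \<Phi>_in by (auto simp: compose_def \<Phi>_def)
      then show "compose X b \<Phi> \<in> G" using GsH[OF H(2)] H(1) union by auto
    qed
    show "space_morphism ?L (limit_group \<H> ge Xs Gs F) X G (inv_into X \<Phi>)"
      unfolding space_morphism_def
    proof (intro conjI ballI)
      show "inv_into X \<Phi> \<in> ?L \<rightarrow> X" using bij_betw_inv_into[OF bij] by (auto simp: bij_betw_def)
      fix b assume "b \<in> G"
      then obtain H where H: "H \<in> \<H>" "b \<in> H" using union by blast
      then obtain a where a: "a \<in> Gs H" "compose X a (\<pi> H) = b" using surj by blast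
      have "b (inv_into X \<Phi> p) = a (p H)" if p: "p \<in> ?L" for p
      proof -
        obtain x where x: "x \<in> X" "p = \<Phi> x" using surj_\<Phi>[OF p] by blast
        then have "b (inv_into X \<Phi> p) = b x" using inj by simp
        also have "\<dots> = a (p H)" using a(2) x H by (auto simp: compose_def \<Phi>_def)
        finally show ?thesis .
      qed
      then have "compose ?L b (inv_into X \<Phi>) = compose ?L a (\<lambda>p. p H)"
        by (auto simp: compose_def)
      then show "compose ?L b (inv_into X \<Phi>) \<in> limit_group \<H> ge Xs Gs F"
        using H a by (auto simp: limit_group_def)
    qed
  qed
  then show ?thesis
    unfolding profinite_def using space_of_orderings_axioms sys fin by (fastforce simp: Xs_def)
qed

section \<open>Groups of sign functions generated by blocks\<close>

definition blockwise :: "('x \<Rightarrow> 'b) \<Rightarrow> 'x set \<Rightarrow> ('x \<Rightarrow> int) \<Rightarrow> bool" where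
  "blockwise \<beta> Y f \<longleftrightarrow> (\<forall>x\<in>Y. \<forall>y\<in>Y. \<beta> x = \<beta> y \<longrightarrow> f x = f y)"

lemma blockwiseD: "\<lbrakk>blockwise \<beta> Y f; x \<in> Y; y \<in> Y; \<beta> x = \<beta> y\<rbrakk> \<Longrightarrow> f x = f y"
  unfolding blockwise_def by blast

text \<open>The parity of the exponent of s in f: even in the first alternative, odd in the second.
  It is one parity for all of Y rather than one for each block, since a polynomial with several real
  roots changes sign on several blocks.\<close>

definition uniform :: "('x \<Rightarrow> 'b) \<Rightarrow> ('x \<Rightarrow> int) \<Rightarrow> 'x set \<Rightarrow> ('x \<Rightarrow> int) \<Rightarrow> bool" where
  "uniform \<beta> s Y f \<longleftrightarrow> blockwise \<beta> Y f \<or> blockwise \<beta> Y (\<lambda>x. f x * s x)"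

lemma uniform_mult:
  assumes f: "uniform \<beta> s Y f" and g: "uniform \<beta> s Y g" and s: "\<And>x. x \<in> Y \<Longrightarrow> s x \<in> {-1, 1}"
  shows "uniform \<beta> s Y (\<lambda>x. f x * g x)"
proof -
  have ss: "s x * s x = 1" if "x \<in> Y" for x using s[OF that] by auto
  have fg: "f x * g x = (f x * s x) * (g x * s x)" if "x \<in> Y" for x
  proof -
    have "(f x * s x) * (g x * s x) = f x * g x * (s x * s x)" by (simp add: ac_simps)
    then show ?thesis using ss[OF that] by simp
  qed
  from f g show ?thesis
    unfolding uniform_def
  proof (elim disjE)
    assume "blockwise \<beta> Y f" "blockwise \<beta> Y g"
    then have "blockwise \<beta> Y (\<lambda>x. f x * g x)" unfolding blockwise_def by metis
    then show "blockwise \<beta> Y (\<lambda>x. f x * g x) \<or> blockwise \<beta> Y (\<lambda>x. f x * g x * s x)" ..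
  next
    assume "blockwise \<beta> Y (\<lambda>x. f x * s x)" "blockwise \<beta> Y (\<lambda>x. g x * s x)"
    then have "blockwise \<beta> Y (\<lambda>x. f x * g x)" using fg unfolding blockwise_def by metis
    then show "blockwise \<beta> Y (\<lambda>x. f x * g x) \<or> blockwise \<beta> Y (\<lambda>x. f x * g x * s x)" ..
  next
    assume "blockwise \<beta> Y (\<lambda>x. f x * s x)" "blockwise \<beta> Y g"
    then have "blockwise \<beta> Y (\<lambda>x. f x * g x * s x)"
      unfolding blockwise_def by (metis mult.assoc mult.commute)
    then show "blockwise \<beta> Y (\<lambda>x. f x * g x) \<or> blockwise \<beta> Y (\<lambda>x. f x * g x * s x)" ..
  next
    assume "blockwise \<beta> Y f" "blockwise \<beta> Y (\<lambda>x. g x * s x)"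
    then have "blockwise \<beta> Y (\<lambda>x. f x * g x * s x)"
      unfolding blockwise_def by (metis mult.assoc)
    then show "blockwise \<beta> Y (\<lambda>x. f x * g x) \<or> blockwise \<beta> Y (\<lambda>x. f x * g x * s x)" ..
  qed
qed

text \<open>Y stands for the union of the blocks on which s changes sign. Both signs of s occur on
  each of them, so for nonempty Y no sign-valued function is both even and odd.\<close>

locale active_class =
  fixes \<beta> :: "'x \<Rightarrow> 'b" and s :: "'x \<Rightarrow> int" and Y :: "'x set"
  assumes sign_s: "\<And>x. x \<in> Y \<Longrightarrow> s x \<in> {-1, 1}"
    and active: "\<And>x. x \<in> Y \<Longrightarrow> \<exists>y\<in>Y. \<beta> y = \<beta> x \<and> s y \<noteq> s x"
begin

lemma not_blockwiseD:
  assumes "uniform \<beta> s Y f" "\<not> blockwise \<beta> Y f" "x \<in> Y" "y \<in> Y" "\<beta> y = \<beta> x" "s y \<noteq> s x"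
  shows "f y = - f x"
proof -
  have "f y * s y = f x * s x"
    using assms by (auto simp: uniform_def blockwise_def)
  moreover have "s x = 1 \<and> s y = -1 \<or> s x = -1 \<and> s y = 1"
    using sign_s[of x] sign_s[of y] assms by auto
  ultimately show ?thesis by auto
qed

text \<open>As in a group extension, the value set of two functions of different parity consists of
  these two only. On a block the even one is constant while the odd one takes both signs, so the
  parity of c decides which of them it equals. The parity is the same on all blocks, hence so is the
  choice.\<close>

lemma value_mixed:
  assumes a: "blockwise \<beta> Y a" and b: "uniform \<beta> s Y b" "\<not> blockwise \<beta> Y b"
    and c: "uniform \<beta> s Y c" and abc: "\<And>x. x \<in> Y \<Longrightarrow> a x = c x \<or> b x = c x"
    and sign: "\<And>x. x \<in> Y \<Longrightarrow> c x \<noteq> 0"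
  shows "(\<forall>x\<in>Y. c x = a x) \<or> (\<forall>x\<in>Y. c x = b x)"
proof (cases "blockwise \<beta> Y c")
  case True
  have "c x = a x" if x: "x \<in> Y" for x
  proof -
    obtain y where y: "y \<in> Y" "\<beta> y = \<beta> x" "s y \<noteq> s x" using active[OF x] by blast
    have "c y = c x" "a y = a x" using blockwiseD[OF True] blockwiseD[OF a] x y by blast+
    moreover have "b y = - b x" using not_blockwiseD[OF b x] y by blast
    ultimately show ?thesis using abc[OF x] abc[OF y(1)] sign[OF x] by auto
  qed
  then show ?thesis by blast
next
  case False
  have "c x = b x" if x: "x \<in> Y" for x
  proof -
    obtain y where y: "y \<in> Y" "\<beta> y = \<beta> x" "s y \<noteq> s x" using active[OF x] by blast
    have "a y = a x" using blockwiseD[OF a] x y by blast+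
    moreover have "b y = - b x" "c y = - c x"
      using not_blockwiseD[OF b x] not_blockwiseD[OF c False x] y by blast+
    ultimately show ?thesis using abc[OF x] abc[OF y(1)] sign[OF x] by auto
  qed
  then show ?thesis by blast
qed

text \<open>Passing to a point of the same block with the other sign of s turns agreement of c with
  a, and likewise with b, into disagreement. Hence c agrees with exactly one of them at each
  point.\<close>

lemma value_opposite:
  assumes a: "uniform \<beta> s Y a" and b: "uniform \<beta> s Y b" and c: "uniform \<beta> s Y c"
    and ab: "blockwise \<beta> Y a = blockwise \<beta> Y b" and ac: "blockwise \<beta> Y a \<noteq> blockwise \<beta> Y c"
    and abc: "\<And>x. x \<in> Y \<Longrightarrow> a x = c x \<or> b x = c x" and sign: "\<And>x. x \<in> Y \<Longrightarrow> c x \<noteq> 0"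
    and x: "x \<in> Y"
  shows "b x = - a x"
proof -
  obtain y where y: "y \<in> Y" "\<beta> y = \<beta> x" "s y \<noteq> s x" using active[OF x] by blast
  note * = abc[OF x] abc[OF y(1)] sign[OF x]
  show ?thesis
  proof (cases "blockwise \<beta> Y c")
    case True
    then have nab: "\<not> blockwise \<beta> Y a" "\<not> blockwise \<beta> Y b" using ab ac by auto
    have "c y = c x" using blockwiseD[OF True] x y by blast
    moreover have "a y = - a x" "b y = - b x"
      using not_blockwiseD[OF a nab(1) x] not_blockwiseD[OF b nab(2) x] y by blast+
    ultimately show ?thesis using * by auto
  next
    case False
    then have nab: "blockwise \<beta> Y a" "blockwise \<beta> Y b" using ab ac by auto
    have "a y = a x" "b y = b x" using blockwiseD[OF nab(1)] blockwiseD[OF nab(2)] x y by blast+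
    moreover have "c y = - c x" using not_blockwiseD[OF c False x] y by blast
    ultimately show ?thesis using * by auto
  qed
qed

text \<open>
  The element \<open>d\<close> is always one of \<open>a\<^sub>1\<close>, \<open>a\<^sub>2\<close>, \<open>b\<close>, \<open>- a\<^sub>3\<close> or, if \<open>a\<^sub>1\<close>, \<open>a\<^sub>3\<close>, \<open>b\<close> agree modulo
  blockwise constant functions, the pointwise choice of \<open>b\<close> where \<open>b \<noteq> a\<^sub>3\<close> and \<open>a\<^sub>1\<close> elsewhere.
\<close>

lemma associativity_on_class:
  assumes sign: "\<And>f x. \<lbrakk>f \<in> {a\<^sub>1, a\<^sub>2, a\<^sub>3, b, c}; x \<in> Y\<rbrakk> \<Longrightarrow> f x \<in> {-1, 1}"
    and uni: "\<And>f. f \<in> {a\<^sub>1, a\<^sub>2, a\<^sub>3, b, c} \<Longrightarrow> uniform \<beta> s Y f"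
    and c: "\<And>x. x \<in> Y \<Longrightarrow> a\<^sub>2 x = c x \<or> a\<^sub>3 x = c x"
    and b: "\<And>x. x \<in> Y \<Longrightarrow> a\<^sub>1 x = b x \<or> c x = b x"
  shows "\<exists>d. uniform \<beta> s Y d \<and> (\<forall>x\<in>Y. d x \<in> {-1, 1} \<and> (a\<^sub>1 x = d x \<or> a\<^sub>2 x = d x) \<and> (d x = b x \<or> a\<^sub>3 x = b x))"
proof -
  let ?e = "blockwise \<beta> Y"
  have u: "uniform \<beta> s Y a\<^sub>1" "uniform \<beta> s Y a\<^sub>2" "uniform \<beta> s Y a\<^sub>3" "uniform \<beta> s Y b" "uniform \<beta> s Y c"
    using uni by auto
  have s1: "x \<in> Y \<Longrightarrow> a\<^sub>1 x \<in> {-1, 1}" and s2: "x \<in> Y \<Longrightarrow> a\<^sub>2 x \<in> {-1, 1}" and s3: "x \<in> Y \<Longrightarrow> a\<^sub>3 x \<in> {-1, 1}"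
    and sb: "x \<in> Y \<Longrightarrow> b x \<in> {-1, 1}" and sc: "x \<in> Y \<Longrightarrow> c x \<in> {-1, 1}" for x
    using sign by blast+
  have b0: "b x \<noteq> 0" and c0: "c x \<noteq> 0" if "x \<in> Y" for x using sb[OF that] sc[OF that] by auto
  \<comment> \<open>If \<open>a\<^sub>2\<close> and \<open>a\<^sub>3\<close> share a parity that c
    lacks, they are opposite. Then \<open>a\<^sub>2\<close> serves as witness, since the value set
    of two opposite functions contains every sign function.\<close>
  consider (opp) "\<And>x. x \<in> Y \<Longrightarrow> a\<^sub>3 x = - a\<^sub>2 x" | (mixed) "?e a\<^sub>2 \<noteq> ?e a\<^sub>3" | (same) "?e a\<^sub>2 = ?e a\<^sub>3" "?e c = ?e a\<^sub>2"
    using value_opposite[OF u(2) u(3) u(5) _ _ c c0] by blast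
  then show ?thesis
  proof cases
    case opp
    then have "(\<forall>x\<in>Y. a\<^sub>2 x \<in> {-1, 1} \<and> (a\<^sub>1 x = a\<^sub>2 x \<or> a\<^sub>2 x = a\<^sub>2 x) \<and> (a\<^sub>2 x = b x \<or> a\<^sub>3 x = b x))"
      using s2 sb by fastforce
    then show ?thesis using u(2) by blast
  next
    case mixed
    then have "(\<forall>x\<in>Y. c x = a\<^sub>2 x) \<or> (\<forall>x\<in>Y. c x = a\<^sub>3 x)"
      using value_mixed[OF _ u(3) _ u(5) c c0] value_mixed[OF _ u(2) _ u(5) _ c0, of a\<^sub>3] c by blast
    then show ?thesis
    proof
      assume "\<forall>x\<in>Y. c x = a\<^sub>2 x"
      then show ?thesis using u(4) sb b by (intro exI[of _ b]) auto
    next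
      assume "\<forall>x\<in>Y. c x = a\<^sub>3 x"
      then show ?thesis using u(1) s1 b by (intro exI[of _ a\<^sub>1]) auto
    qed
  next
    case same
    show ?thesis
    proof (cases "?e a\<^sub>1 = ?e c")
      case False
      then have "(\<forall>x\<in>Y. b x = a\<^sub>1 x) \<or> (\<forall>x\<in>Y. b x = c x)"
        using value_mixed[OF _ u(5) _ u(4) b b0] value_mixed[OF _ u(1) _ u(4) _ b0, of c] b by blast
      then show ?thesis
      proof
        assume "\<forall>x\<in>Y. b x = a\<^sub>1 x"
        then show ?thesis using u(1) s1 by (intro exI[of _ a\<^sub>1]) auto
      next
        assume "\<forall>x\<in>Y. b x = c x"
        then show ?thesis using u(2) s2 c by (intro exI[of _ a\<^sub>2]) auto
      qed
    next
      case e1: True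
      show ?thesis
      proof (cases "?e b = ?e a\<^sub>1")
        case True
        \<comment> \<open>Where b differs from \<open>a\<^sub>3\<close>, the value of d must be that
          of b, and the hypotheses on b and c make it a value of \<open>a\<^sub>1\<close> or
          \<open>a\<^sub>2\<close>. Elsewhere any choice between \<open>a\<^sub>1\<close> and
          \<open>a\<^sub>2\<close> is good.\<close>
        define d where "d x = (if b x = a\<^sub>3 x then a\<^sub>1 x else b x)" for x
        have "uniform \<beta> s Y d"
        proof (cases "?e b")
          case True
          then have "?e b" "?e a\<^sub>3" "?e a\<^sub>1" using same e1 \<open>?e b = ?e a\<^sub>1\<close> by auto
          then have "?e d" unfolding blockwise_def d_def by metis
          then show ?thesis by (simp add: uniform_def)
        next
          case False
          then have "\<not> ?e b" "\<not> ?e a\<^sub>3" "\<not> ?e a\<^sub>1" using same e1 \<open>?e b = ?e a\<^sub>1\<close> by auto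
          then have odd: "?e (\<lambda>x. b x * s x)" "?e (\<lambda>x. a\<^sub>3 x * s x)" "?e (\<lambda>x. a\<^sub>1 x * s x)"
            using u by (auto simp: uniform_def)
          \<comment> \<open>Multiplication by the nonzero \<open>s x\<close> does not affect the
            test \<open>b x = a\<^sub>3 x\<close>, so the odd case reduces to blockwise
            functions.\<close>
          have d: "d x * s x = (if b x * s x = a\<^sub>3 x * s x then a\<^sub>1 x * s x else b x * s x)" if "x \<in> Y" for x
            using sign_s[OF that] by (auto simp: d_def)
          have "?e (\<lambda>x. d x * s x)"
            unfolding blockwise_def
          proof (intro ballI impI)
            fix x y assume "x \<in> Y" "y \<in> Y" "\<beta> x = \<beta> y"
            note xy = this
            show "d x * s x = d y * s y"
              using blockwiseD[OF odd(1) xy] blockwiseD[OF odd(2) xy] blockwiseD[OF odd(3) xy]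
              by (simp only: d[OF xy(1)] d[OF xy(2)])
          qed
          then show ?thesis by (simp add: uniform_def)
        qed
        moreover have "d x \<in> {-1, 1} \<and> (a\<^sub>1 x = d x \<or> a\<^sub>2 x = d x) \<and> (d x = b x \<or> a\<^sub>3 x = b x)" if "x \<in> Y" for x
          using b[OF that] c[OF that] s1[OF that] sb[OF that] by (auto simp: d_def)
        ultimately show ?thesis by blast
      next
        case False
        \<comment> \<open>Since b has another parity than \<open>a\<^sub>1\<close> and c, these two
          are opposite. At each point c is \<open>a\<^sub>2\<close> or \<open>a\<^sub>3\<close>, so
          \<open>- a\<^sub>3\<close> equals \<open>a\<^sub>2\<close> or \<open>a\<^sub>1\<close>
          there, and every sign lies in the value set of \<open>- a\<^sub>3\<close> and
          \<open>a\<^sub>3\<close>.\<close>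
        have ca: "c x = - a\<^sub>1 x" if "x \<in> Y" for x
          using value_opposite[OF u(1) u(5) u(4) _ _ b b0 that] e1 False by blast
        have "- a\<^sub>3 x \<in> {-1, 1} \<and> (a\<^sub>1 x = - a\<^sub>3 x \<or> a\<^sub>2 x = - a\<^sub>3 x) \<and> (- a\<^sub>3 x = b x \<or> a\<^sub>3 x = b x)" if "x \<in> Y" for x
          using ca[OF that] c[OF that] s1[OF that] s2[OF that] s3[OF that] sb[OF that] by auto
        moreover have "uniform \<beta> s Y (\<lambda>x. - a\<^sub>3 x)"
          using u(3) by (auto simp: uniform_def blockwise_def)
        ultimately show ?thesis by (intro exI[of _ "\<lambda>x. - a\<^sub>3 x"]) blast
      qed
    qed
  qed
qed

end

text \<open>
  A block is a fibre of \<open>\<beta>\<close>.  Since at most one \<open>s i\<close> changes sign on a given block, the group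
  below is a direct product over \<open>i\<close> of group extensions of spaces in which all sign functions
  are allowed.
\<close>

locale block_space =
  fixes X :: "'x set" and \<beta> :: "'x \<Rightarrow> 'b" and S :: "'i set" and s :: "'i \<Rightarrow> 'x \<Rightarrow> int"
  assumes nonempty: "X \<noteq> {}" and finite_blocks: "finite (\<beta> ` X)" and finite_S: "finite S"
    and sign: "\<And>i x. \<lbrakk>i \<in> S; x \<in> X\<rbrakk> \<Longrightarrow> s i x \<in> {-1, 1}"
    and separated: "\<And>i j x. \<lbrakk>i \<in> S; j \<in> S; i \<noteq> j; x \<in> X\<rbrakk> \<Longrightarrow>
      (\<forall>y\<in>X. \<beta> y = \<beta> x \<longrightarrow> s i y = s i x) \<or> (\<forall>y\<in>X. \<beta> y = \<beta> x \<longrightarrow> s j y = s j x)"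

text \<open>For sign-valued s, the group generated by the blockwise sign functions and the
  \<open>s i\<close>. Signs are their own inverses, so a factorisation of f is recorded by moving
  the product to its side; only the parity of \<open>e i\<close> matters.\<close>

definition block_group :: "'x set \<Rightarrow> ('x \<Rightarrow> 'b) \<Rightarrow> 'i set \<Rightarrow> ('i \<Rightarrow> 'x \<Rightarrow> int) \<Rightarrow> ('x \<Rightarrow> int) set" where
  "block_group X \<beta> S s =
     {f \<in> X \<rightarrow>\<^sub>E {-1, 1}. \<exists>e :: 'i \<Rightarrow> nat. blockwise \<beta> X (\<lambda>x. f x * (\<Prod>i\<in>S. s i x ^ e i))}"

section \<open>Gluing the active classes into one finite group\<close>

context block_space
begin

abbreviation "H \<equiv> block_group X \<beta> S s"

definition active :: "'i \<Rightarrow> 'x \<Rightarrow> bool" where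
  "active i x \<longleftrightarrow> (\<exists>y\<in>X. \<beta> y = \<beta> x \<and> s i y \<noteq> s i x)"

definition Y :: "'i \<Rightarrow> 'x set" where
  "Y i = {x \<in> X. active i x}"

lemma active_block: "\<lbrakk>active i x; x \<in> X; y \<in> X; \<beta> y = \<beta> x\<rbrakk> \<Longrightarrow> active i y"
  unfolding active_def by metis

lemma active_unique: "\<lbrakk>active i x; active j x; i \<in> S; j \<in> S; x \<in> X\<rbrakk> \<Longrightarrow> i = j"
  using separated[of i j x] unfolding active_def by blast

lemma inactive: "\<lbrakk>\<not> active i x; y \<in> X; \<beta> y = \<beta> x\<rbrakk> \<Longrightarrow> s i y = s i x"
  unfolding active_def by blast

lemma active_class:
  assumes "i \<in> S"
  shows "active_class \<beta> (s i) (Y i)"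
proof
  show "s i x \<in> {-1, 1}" if "x \<in> Y i" for x using sign[OF assms] that by (simp add: Y_def)
  show "\<exists>y\<in>Y i. \<beta> y = \<beta> x \<and> s i y \<noteq> s i x" if x: "x \<in> Y i" for x
  proof -
    obtain y where y: "y \<in> X" "\<beta> y = \<beta> x" "s i y \<noteq> s i x" using x unfolding Y_def active_def by blast
    then have "y \<in> Y i" using active_block[of i x y] x by (simp add: Y_def)
    then show ?thesis using y by blast
  qed
qed

lemma sign_power: "\<lbrakk>i \<in> S; x \<in> X\<rbrakk> \<Longrightarrow> s i x ^ n = (if even n then 1 else s i x)"
  using sign[of i x] by auto

text \<open>Membership is local: one parity on each \<open>Y i\<close>, constancy on blocks without
  a sign change, and nothing that relates different i. This is the direct product decomposition. The
  exponent \<open>e i\<close> is read off from the parity on \<open>Y i\<close>; on a block where i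
  is active all other factors are constant.\<close>

lemma block_groupI:
  assumes f: "f \<in> X \<rightarrow>\<^sub>E {-1, 1}" and uni: "\<And>i. i \<in> S \<Longrightarrow> uniform \<beta> (s i) (Y i) f"
    and const: "\<And>x y. \<lbrakk>x \<in> X; y \<in> X; \<beta> x = \<beta> y; \<forall>i\<in>S. \<not> active i x\<rbrakk> \<Longrightarrow> f x = f y"
  shows "f \<in> H"
proof -
  define e :: "'i \<Rightarrow> nat" where "e i = (if blockwise \<beta> (Y i) f then 0 else 1)" for i
  have "f x * (\<Prod>i\<in>S. s i x ^ e i) = f y * (\<Prod>i\<in>S. s i y ^ e i)"
    if xy: "x \<in> X" "y \<in> X" "\<beta> x = \<beta> y" for x y
  proof (cases "\<exists>i\<in>S. active i x")
    case True
    then obtain i where i: "i \<in> S" "active i x" by blast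
    have Y: "x \<in> Y i" "y \<in> Y i" using i xy active_block[of i x y] by (auto simp: Y_def)
    have "f x * s i x ^ e i = f y * s i y ^ e i"
    proof (cases "blockwise \<beta> (Y i) f")
      case True
      then show ?thesis using blockwiseD[OF True Y xy(3)] by (simp add: e_def)
    next
      case False
      then have odd: "blockwise \<beta> (Y i) (\<lambda>x. f x * s i x)" using uni[OF i(1)] by (simp add: uniform_def)
      then show ?thesis using blockwiseD[OF odd Y xy(3)] False by (simp add: e_def)
    qed
    moreover have "(\<Prod>j\<in>S - {i}. s j x ^ e j) = (\<Prod>j\<in>S - {i}. s j y ^ e j)"
    proof (rule prod.cong[OF refl])
      fix j assume "j \<in> S - {i}"
      then have "\<not> active j x" using active_unique[of i x j] i xy by blast
      then show "s j x ^ e j = s j y ^ e j" using inactive[of j x y] xy by simp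
    qed
    ultimately show ?thesis
      using i(1) by (simp add: prod.remove[OF finite_S i(1)] mult.assoc[symmetric])
  next
    case False
    then have "(\<Prod>i\<in>S. s i x ^ e i) = (\<Prod>i\<in>S. s i y ^ e i)"
      using inactive[of _ x y] xy by (intro prod.cong) auto
    then show ?thesis using const[OF xy] False by simp
  qed
  then show ?thesis using f by (auto simp: block_group_def blockwise_def)
qed

lemma prod_sign: "x \<in> X \<Longrightarrow> T \<subseteq> S \<Longrightarrow> (\<Prod>i\<in>T. s i x ^ e i) \<noteq> 0"
  using sign finite_subset[OF _ finite_S] by (fastforce simp: prod_zero_iff)

text \<open>On a block of \<open>Y i\<close> the factors other than \<open>s i\<close> are constant
  and nonzero, so they cancel and the parity of \<open>e i\<close> remains. Together with
  \<open>block_group_const\<close> this is the converse of \<open>block_groupI\<close>.\<close>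

lemma uniform_block_group:
  assumes f: "f \<in> H" and i: "i \<in> S"
  shows "uniform \<beta> (s i) (Y i) f"
proof -
  obtain e :: "'i \<Rightarrow> nat" where e: "blockwise \<beta> X (\<lambda>x. f x * (\<Prod>i\<in>S. s i x ^ e i))"
    using f by (auto simp: block_group_def)
  have *: "f x * s i x ^ e i = f y * s i y ^ e i" if xy: "x \<in> Y i" "y \<in> Y i" "\<beta> x = \<beta> y" for x y
  proof -
    have X: "x \<in> X" "y \<in> X" using xy by (auto simp: Y_def)
    have R: "(\<Prod>j\<in>S - {i}. s j x ^ e j) = (\<Prod>j\<in>S - {i}. s j y ^ e j)"
    proof (rule prod.cong[OF refl])
      fix j assume "j \<in> S - {i}"
      then have "\<not> active j x" using active_unique[of i x j] i xy by (auto simp: Y_def)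
      then show "s j x ^ e j = s j y ^ e j" using inactive[of j x y] xy X by simp
    qed
    have "f x * (\<Prod>i\<in>S. s i x ^ e i) = f y * (\<Prod>i\<in>S. s i y ^ e i)"
      using blockwiseD[OF e X xy(3)] .
    then have "f x * s i x ^ e i * (\<Prod>j\<in>S - {i}. s j x ^ e j) = f y * s i y ^ e i * (\<Prod>j\<in>S - {i}. s j x ^ e j)"
      using R by (simp add: prod.remove[OF finite_S i] mult.assoc[symmetric])
    then show ?thesis using prod_sign[OF X(1), of "S - {i}" e] by simp
  qed
  show ?thesis
  proof (cases "even (e i)")
    case True
    then have "s i x ^ e i = 1" if "x \<in> Y i" for x
      using that sign_power[OF i] by (simp add: Y_def)
    then have "f x = f y" if "x \<in> Y i" "y \<in> Y i" "\<beta> x = \<beta> y" for x y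
      using *[OF that] that by simp
    then have "blockwise \<beta> (Y i) f"
      unfolding blockwise_def by blast
    then show ?thesis by (simp add: uniform_def)
  next
    case False
    then have "s i x ^ e i = s i x" if "x \<in> Y i" for x
      using that sign_power[OF i] by (simp add: Y_def)
    then have "f x * s i x = f y * s i y" if "x \<in> Y i" "y \<in> Y i" "\<beta> x = \<beta> y" for x y
      using *[OF that] that by simp
    then have "blockwise \<beta> (Y i) (\<lambda>x. f x * s i x)"
      unfolding blockwise_def by blast
    then show ?thesis by (simp add: uniform_def)
  qed
qed

lemma block_group_const:
  assumes f: "f \<in> H" and xy: "x \<in> X" "y \<in> X" "\<beta> x = \<beta> y" "\<forall>i\<in>S. \<not> active i x"
  shows "f x = f y"
proof -
  obtain e :: "'i \<Rightarrow> nat" where e: "blockwise \<beta> X (\<lambda>x. f x * (\<Prod>i\<in>S. s i x ^ e i))"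
    using f by (auto simp: block_group_def)
  have "(\<Prod>i\<in>S. s i x ^ e i) = (\<Prod>i\<in>S. s i y ^ e i)"
    using inactive[of _ x y] xy by (intro prod.cong) auto
  then show ?thesis using blockwiseD[OF e xy(1-3)] prod_sign[OF xy(2), of S e] by simp
qed

lemma block_group_sign: "f \<in> H \<Longrightarrow> x \<in> X \<Longrightarrow> f x \<in> {-1, 1}"
  by (auto simp: block_group_def PiE_iff)

lemma blockwise_in_block_group:
  assumes "f \<in> X \<rightarrow>\<^sub>E {-1, 1}" "blockwise \<beta> X f"
  shows "f \<in> H"
  using assms by (auto simp: block_group_def intro!: exI[of _ "\<lambda>_. 0"])

lemma mult_block_group:
  assumes f: "f \<in> H" and g: "g \<in> H"
  shows "(\<lambda>x\<in>X. f x * g x) \<in> H"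
proof (rule block_groupI)
  have "f x * g x \<in> {-1, 1}" if "x \<in> X" for x
    using block_group_sign[OF f that] block_group_sign[OF g that] by auto
  then show "(\<lambda>x\<in>X. f x * g x) \<in> X \<rightarrow>\<^sub>E {-1, 1}" by auto
  show "uniform \<beta> (s i) (Y i) (\<lambda>x\<in>X. f x * g x)" if i: "i \<in> S" for i
  proof -
    have "uniform \<beta> (s i) (Y i) (\<lambda>x. f x * g x)"
      using uniform_block_group[OF f i] uniform_block_group[OF g i] active_class.sign_s[OF active_class[OF i]]
      by (rule uniform_mult)
    then show ?thesis by (auto simp: uniform_def blockwise_def Y_def)
  qed
  show "(\<lambda>x\<in>X. f x * g x) x = (\<lambda>x\<in>X. f x * g x) y"
    if "x \<in> X" "y \<in> X" "\<beta> x = \<beta> y" "\<forall>i\<in>S. \<not> active i x" for x y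
    using block_group_const[OF f that] block_group_const[OF g that] that by simp
qed

text \<open>The function \<open>s i\<close> is odd on \<open>Y i\<close> and, as the active index is
  unique, even on every other \<open>Y j\<close>.\<close>

lemma generator_in_block_group:
  assumes i: "i \<in> S"
  shows "(\<lambda>x\<in>X. s i x) \<in> H"
proof (rule block_groupI)
  show "(\<lambda>x\<in>X. s i x) \<in> X \<rightarrow>\<^sub>E {-1, 1}" using sign[OF i] by auto
  show "uniform \<beta> (s j) (Y j) (\<lambda>x\<in>X. s i x)" if j: "j \<in> S" for j
  proof (cases "i = j")
    case True
    have "s i x * s i x = 1" if "x \<in> X" for x using sign[OF i that] by auto
    then show ?thesis using True by (auto simp: uniform_def blockwise_def Y_def)
  next
    case False
    then show ?thesis using active_unique[of i _ j] i j inactive[of i]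
      by (auto simp: uniform_def blockwise_def Y_def)
  qed
  show "(\<lambda>x\<in>X. s i x) x = (\<lambda>x\<in>X. s i x) y"
    if "x \<in> X" "y \<in> X" "\<beta> x = \<beta> y" "\<forall>i\<in>S. \<not> active i x" for x y
    using inactive[of i x y] i that by simp
qed

text \<open>An element of the group factors through \<open>\<kappa>\<close>, which records the block
  of a point and its signs \<open>s i\<close>; both range over finite sets.\<close>

lemma finite_block_group: "finite H"
proof -
  define \<kappa> where "\<kappa> x = (\<beta> x, {i \<in> S. s i x = 1})" for x
  have "finite (\<kappa> ` X)"
  proof (rule finite_subset)
    show "\<kappa> ` X \<subseteq> \<beta> ` X \<times> Pow S" by (auto simp: \<kappa>_def)
  qed (use finite_blocks finite_S in simp)
  then have "finite ((\<lambda>g. \<lambda>x\<in>X. g (\<kappa> x)) ` (\<kappa> ` X \<rightarrow>\<^sub>E {-1, 1 :: int}))"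
    by (intro finite_imageI[OF finite_PiE]) auto
  moreover have "H \<subseteq> (\<lambda>g. \<lambda>x\<in>X. g (\<kappa> x)) ` (\<kappa> ` X \<rightarrow>\<^sub>E {-1, 1})"
  proof
    fix f assume f: "f \<in> H"
    then obtain e :: "'i \<Rightarrow> nat" where e: "blockwise \<beta> X (\<lambda>x. f x * (\<Prod>i\<in>S. s i x ^ e i))"
      by (auto simp: block_group_def)
    have \<kappa>: "f x = f y" if xy: "x \<in> X" "y \<in> X" "\<kappa> x = \<kappa> y" for x y
    proof -
      have "s i x = s i y" if "i \<in> S" for i
      proof -
        have "s i x = 1 \<longleftrightarrow> s i y = 1" using xy(3) that by (auto simp: \<kappa>_def)
        then show ?thesis using sign[OF that xy(1)] sign[OF that xy(2)] by auto
      qed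
      then have "(\<Prod>i\<in>S. s i x ^ e i) = (\<Prod>i\<in>S. s i y ^ e i)" by simp
      moreover have "\<beta> x = \<beta> y" using xy(3) by (simp add: \<kappa>_def)
      ultimately show ?thesis using blockwiseD[OF e xy(1,2)] prod_sign[OF xy(2), of S e] by simp
    qed
    define g where "g = (\<lambda>k\<in>\<kappa> ` X. f (inv_into X \<kappa> k))"
    have g: "g (\<kappa> x) = f x" if "x \<in> X" for x
      using \<kappa>[of "inv_into X \<kappa> (\<kappa> x)" x] that by (simp add: g_def inv_into_into f_inv_into_f)
    have "f = (\<lambda>x\<in>X. g (\<kappa> x))"
      using f g by (intro extensionalityI[of _ X]) (auto simp: block_group_def PiE_iff)
    moreover have "g \<in> \<kappa> ` X \<rightarrow>\<^sub>E {-1, 1}"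
    proof (rule PiE_I)
      show "g k \<in> {-1, 1}" if "k \<in> \<kappa> ` X" for k
      proof -
        obtain x where x: "x \<in> X" "k = \<kappa> x" using \<open>k \<in> \<kappa> ` X\<close> by blast
        then show ?thesis using g[OF x(1)] block_group_sign[OF f x(1)] by simp
      qed
    qed (simp add: g_def)
    ultimately show "f \<in> (\<lambda>g. \<lambda>x\<in>X. g (\<kappa> x)) ` (\<kappa> ` X \<rightarrow>\<^sub>E {-1, 1})" by blast
  qed
  ultimately show ?thesis by (rule finite_subset[rotated])
qed

text \<open>As membership in the group is local, witnesses may be chosen independently on each
  \<open>Y i\<close> and on the inactive blocks.\<close>

lemma associativity_block_group:
  assumes a: "a\<^sub>1 \<in> H" "a\<^sub>2 \<in> H" "a\<^sub>3 \<in> H"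
    and c: "c \<in> value_set X H a\<^sub>2 a\<^sub>3" and b: "b \<in> value_set X H a\<^sub>1 c"
  shows "\<exists>d \<in> value_set X H a\<^sub>1 a\<^sub>2. b \<in> value_set X H d a\<^sub>3"
proof -
  have cH: "c \<in> H" and bH: "b \<in> H" using b c by (auto simp: value_set_def)
  have c': "a\<^sub>2 x = c x \<or> a\<^sub>3 x = c x" and b': "a\<^sub>1 x = b x \<or> c x = b x" if "x \<in> X" for x
    using b c that by (auto simp: value_set_def)
  have "\<exists>d. uniform \<beta> (s i) (Y i) d \<and>
      (\<forall>x\<in>Y i. d x \<in> {-1, 1} \<and> (a\<^sub>1 x = d x \<or> a\<^sub>2 x = d x) \<and> (d x = b x \<or> a\<^sub>3 x = b x))" if i: "i \<in> S" for i
  proof (rule active_class.associativity_on_class[OF active_class[OF i]])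
    show "f x \<in> {-1, 1}" if "f \<in> {a\<^sub>1, a\<^sub>2, a\<^sub>3, b, c}" "x \<in> Y i" for f x
      using that a bH cH block_group_sign unfolding Y_def by blast
    show "uniform \<beta> (s i) (Y i) f" if "f \<in> {a\<^sub>1, a\<^sub>2, a\<^sub>3, b, c}" for f
      using that a bH cH uniform_block_group[OF _ i] by blast
  qed (use b' c' in \<open>auto simp: Y_def\<close>)
  then obtain d where d: "\<And>i. i \<in> S \<Longrightarrow> uniform \<beta> (s i) (Y i) (d i)"
      "\<And>i x. \<lbrakk>i \<in> S; x \<in> Y i\<rbrakk> \<Longrightarrow>
         d i x \<in> {-1, 1} \<and> (a\<^sub>1 x = d i x \<or> a\<^sub>2 x = d i x) \<and> (d i x = b x \<or> a\<^sub>3 x = b x)"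
    by metis
  \<comment> \<open>The active index is unique, so \<open>THE\<close> is well defined. On an
    inactive block all functions involved are constant, so the pointwise choice is constant there
    too.\<close>
  define D where "D = (\<lambda>x\<in>X. if \<exists>i\<in>S. active i x then d (THE i. i \<in> S \<and> active i x) x
    else if b x = a\<^sub>3 x then a\<^sub>1 x else b x)"
  have D_active: "D x = d i x" if "i \<in> S" "x \<in> Y i" for i x
  proof -
    have "(THE i. i \<in> S \<and> active i x) = i"
      using that active_unique[of _ x i] by (intro the_equality) (auto simp: Y_def)
    then show ?thesis using that by (auto simp: D_def Y_def)
  qed
  have D_inactive: "D x = (if b x = a\<^sub>3 x then a\<^sub>1 x else b x)" if "x \<in> X" "\<forall>i\<in>S. \<not> active i x" for x
    using that by (simp add: D_def)
  have D: "D x \<in> {-1, 1} \<and> (a\<^sub>1 x = D x \<or> a\<^sub>2 x = D x) \<and> (D x = b x \<or> a\<^sub>3 x = b x)" if x: "x \<in> X" for x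
  proof (cases "\<exists>i\<in>S. active i x")
    case True
    then obtain i where "i \<in> S" "x \<in> Y i" using x by (auto simp: Y_def)
    then show ?thesis using D_active d(2) by simp
  next
    case False
    then show ?thesis
      using D_inactive[OF x] b'[OF x] c'[OF x] block_group_sign[OF a(1) x] block_group_sign[OF bH x] by auto
  qed
  have "D \<in> H"
  proof (rule block_groupI)
    show "D \<in> X \<rightarrow>\<^sub>E {-1, 1}"
    proof (rule PiE_I)
      show "D x \<in> {-1, 1}" if "x \<in> X" for x using D[OF that] by blast
    qed (simp add: D_def)
    show "uniform \<beta> (s i) (Y i) D" if i: "i \<in> S" for i
      using d(1)[OF i] D_active[OF i] by (auto simp: uniform_def blockwise_def)
    show "D x = D y" if "x \<in> X" "y \<in> X" "\<beta> x = \<beta> y" "\<forall>i\<in>S. \<not> active i x" for x y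
    proof -
      have "\<forall>i\<in>S. \<not> active i y" using active_block[of _ y x] that by auto
      then show ?thesis
        using D_inactive that block_group_const[OF a(1) that] block_group_const[OF a(3) that]
          block_group_const[OF bH that] by simp
    qed
  qed
  then show ?thesis using D bH by (intro bexI[of _ D]) (auto simp: value_set_def)
qed

lemma minus_one_block_group: "(\<lambda>x\<in>X. -1) \<in> H"
  by (rule blockwise_in_block_group) (auto simp: blockwise_def)

text \<open>The function -1 is the product of the \<open>\<delta> {k}\<close> over all blocks k, so
  the character is -1 at one of them, which selects a block. Closure under value sets makes the
  character depend only on restrictions to this block. There the group is generated by -1 and at
  most one \<open>s i\<close>, whose character value selects the point.\<close>

lemma characters_block_group:
  assumes sgn: "\<chi> \<in> H \<rightarrow> {-1, 1}"
    and mult: "\<And>a b. \<lbrakk>a \<in> H; b \<in> H\<rbrakk> \<Longrightarrow> \<chi> (\<lambda>x\<in>X. a x * b x) = \<chi> a * \<chi> b"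
    and neg: "\<chi> (\<lambda>x\<in>X. -1) = -1"
    and D: "\<And>a b c. \<lbrakk>a \<in> H; b \<in> H; \<chi> a = 1; \<chi> b = 1; c \<in> value_set X H a b\<rbrakk> \<Longrightarrow> \<chi> c = 1"
  shows "\<exists>x\<in>X. \<forall>a\<in>H. \<chi> a = a x"
proof -
  note m1 = minus_one_block_group
  define \<delta> where "\<delta> A = (\<lambda>x\<in>X. if \<beta> x \<in> A then -1 else 1 :: int)" for A
  have \<delta>H: "\<delta> A \<in> H" for A
    by (rule blockwise_in_block_group) (auto simp: \<delta>_def blockwise_def)
  have \<chi>_neg: "\<chi> (\<lambda>x\<in>X. - a x) = - \<chi> a" "(\<lambda>x\<in>X. - a x) \<in> H" if "a \<in> H" for a
  proof -
    have eq: "(\<lambda>x\<in>X. (\<lambda>x\<in>X. -1) x * a x) = (\<lambda>x\<in>X. - a x)" by auto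
    then show "\<chi> (\<lambda>x\<in>X. - a x) = - \<chi> a" using mult[OF m1 that] neg by simp
    show "(\<lambda>x\<in>X. - a x) \<in> H" using mult_block_group[OF m1 that] eq by simp
  qed
  have "\<exists>k\<in>\<beta> ` X. \<chi> (\<delta> {k}) \<noteq> 1"
  proof (rule ccontr)
    assume "\<not> ?thesis"
    then have *: "\<chi> (\<delta> {k}) = 1" if "k \<in> \<beta> ` X" for k using that by blast
    have "\<chi> (\<delta> A) = 1" if "finite A" "A \<subseteq> \<beta> ` X" for A
      using that
    proof (induction A)
      case empty
      have "(\<lambda>x\<in>X. \<delta> {} x * \<delta> {} x) = \<delta> {}" by (auto simp: \<delta>_def)
      then have "\<chi> (\<delta> {}) = \<chi> (\<delta> {}) * \<chi> (\<delta> {})" using mult[OF \<delta>H \<delta>H, of "{}" "{}"] by simp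
      moreover have "\<chi> (\<delta> {}) \<in> {-1, 1}" using sgn \<delta>H by blast
      ultimately show ?case by auto
    next
      case (insert k A)
      then have "(\<lambda>x\<in>X. \<delta> {k} x * \<delta> A x) = \<delta> (insert k A)" by (auto simp: \<delta>_def)
      then show ?case using mult[OF \<delta>H \<delta>H, of "{k}" A] insert * by auto
    qed
    then have "\<chi> (\<delta> (\<beta> ` X)) = 1" using finite_blocks by blast
    moreover have "\<delta> (\<beta> ` X) = (\<lambda>x\<in>X. -1)" by (auto simp: \<delta>_def)
    ultimately show False using neg by simp
  qed
  then obtain x\<^sub>0 where x0: "x\<^sub>0 \<in> X" "\<chi> (\<delta> {\<beta> x\<^sub>0}) \<noteq> 1" by blast
  have \<delta>0: "\<chi> (\<delta> {\<beta> x\<^sub>0}) = -1" using x0(2) sgn \<delta>H[of "{\<beta> x\<^sub>0}"] by blast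
  have one: "\<chi> a = 1" if a: "a \<in> H" and one: "\<And>x. \<lbrakk>x \<in> X; \<beta> x = \<beta> x\<^sub>0\<rbrakk> \<Longrightarrow> a x = 1" for a
  proof (rule ccontr)
    assume "\<chi> a \<noteq> 1"
    then have "\<chi> a = -1" using sgn a by blast
    \<comment> \<open>On the selected block \<open>- a\<close> equals -1, and off it the negative of
      \<open>\<delta> {\<beta> x\<^sub>0}\<close> does. Both negatives lie in the kernel, so -1
      would too.\<close>
    moreover have "(\<lambda>x\<in>X. -1) \<in> value_set X H (\<lambda>x\<in>X. - a x) (\<lambda>x\<in>X. - \<delta> {\<beta> x\<^sub>0} x)"
      using m1 one by (auto simp: value_set_def \<delta>_def)
    ultimately have "\<chi> (\<lambda>x\<in>X. -1) = 1"
      using D[OF \<chi>_neg(2)[OF a] \<chi>_neg(2)[OF \<delta>H[of "{\<beta> x\<^sub>0}"]]]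
        \<chi>_neg(1)[OF a] \<chi>_neg(1)[OF \<delta>H[of "{\<beta> x\<^sub>0}"]] \<delta>0 by simp
    then show False using neg by simp
  qed
  have const: "\<chi> a = a x" if a: "a \<in> H" and x: "x \<in> X" "\<beta> x = \<beta> x\<^sub>0"
    and const: "\<And>y. \<lbrakk>y \<in> X; \<beta> y = \<beta> x\<^sub>0\<rbrakk> \<Longrightarrow> a y = a x" for a x
  proof (cases "a x = 1")
    case True
    then show ?thesis using one[OF a] const by simp
  next
    case False
    then have "a x = -1" using block_group_sign[OF a x(1)] by simp
    then show ?thesis using one[OF \<chi>_neg(2)[OF a]] \<chi>_neg(1)[OF a] const by simp
  qed
  show ?thesis
  proof (cases "\<exists>i\<in>S. active i x\<^sub>0")
    case False
    then have "\<chi> a = a x\<^sub>0" if "a \<in> H" for a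
      using const[OF that x0(1)] block_group_const[OF that x0(1)] by metis
    then show ?thesis using x0(1) by blast
  next
    case True
    then obtain i where i: "i \<in> S" "active i x\<^sub>0" by blast
    define p where "p = (\<lambda>x\<in>X. s i x)"
    have pH: "p \<in> H" unfolding p_def by (rule generator_in_block_group[OF i(1)])
    \<comment> \<open>An active block contains both signs of \<open>s i\<close>, so one of its
      points has the sign prescribed by \<open>\<chi> p\<close>.\<close>
    obtain x where x: "x \<in> X" "\<beta> x = \<beta> x\<^sub>0" "p x = \<chi> p"
    proof -
      obtain y where y: "y \<in> X" "\<beta> y = \<beta> x\<^sub>0" "s i y \<noteq> s i x\<^sub>0" using i(2) unfolding active_def by blast
      have "\<chi> p \<in> {-1, 1}" using sgn pH by blast
      then have "\<chi> p = s i y \<or> \<chi> p = s i x\<^sub>0" using y(3) sign[OF i(1) y(1)] sign[OF i(1) x0(1)] by auto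
      then show ?thesis using that[of y] that[of x\<^sub>0] y x0(1) by (auto simp: p_def)
    qed
    have Y: "y \<in> Y i" if "y \<in> X" "\<beta> y = \<beta> x\<^sub>0" for y
      using active_block[OF i(2) x0(1)] that by (auto simp: Y_def)
    have "\<chi> a = a x" if a: "a \<in> H" for a
      using uniform_block_group[OF a i(1)] unfolding uniform_def
    proof
      assume "blockwise \<beta> (Y i) a"
      then show ?thesis
        using const[OF a x(1,2)] blockwiseD[of \<beta> "Y i" a] Y x by metis
    next
      assume b: "blockwise \<beta> (Y i) (\<lambda>x. a x * s i x)"
      have "\<chi> (\<lambda>x\<in>X. a x * p x) = (\<lambda>x\<in>X. a x * p x) x"
      proof (rule const[OF mult_block_group[OF a pH] x(1,2)])
        fix y assume y: "y \<in> X" "\<beta> y = \<beta> x\<^sub>0"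
        then show "(\<lambda>x\<in>X. a x * p x) y = (\<lambda>x\<in>X. a x * p x) x"
          using blockwiseD[OF b Y[OF y] Y[OF x(1,2)]] x y by (simp add: p_def)
      qed
      then have "\<chi> a * \<chi> p = a x * \<chi> p" using mult[OF a pH] x by simp
      moreover have "\<chi> p \<in> {-1, 1}" using sgn pH by blast
      ultimately show ?thesis by auto
    qed
    then show ?thesis using x(1) by blast
  qed
qed

lemma sign_prespace_block_group: "sign_prespace X H"
proof (rule sign_prespace.intro)
  show "X \<noteq> {}" by (rule nonempty)
  show "H \<subseteq> X \<rightarrow>\<^sub>E {-1, 1}" by (auto simp: block_group_def)
  show "(\<lambda>x\<in>X. a x * b x) \<in> H" if "a \<in> H" "b \<in> H" for a b using that by (rule mult_block_group)
  show "(\<lambda>x\<in>X. -1) \<in> H" by (rule minus_one_block_group)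
qed (rule characters_block_group associativity_block_group; assumption)+

end

section \<open>Separating coprime polynomials by rational cuts\<close>

text \<open>
  The nonnegative polynomials of an ordering of \<open>\<rat>(x)\<close>.  The polynomial itself plays the role of
  its value at the generic point \<open>x\<close>.
\<close>

locale polynomial_cone =
  fixes C :: "rat poly set"
  assumes add: "\<lbrakk>p \<in> C; q \<in> C\<rbrakk> \<Longrightarrow> p + q \<in> C"
    and mult: "\<lbrakk>p \<in> C; q \<in> C\<rbrakk> \<Longrightarrow> p * q \<in> C"
    and total: "p \<in> C \<or> - p \<in> C"
    and antisym: "\<lbrakk>p \<in> C; - p \<in> C\<rbrakk> \<Longrightarrow> p = 0"
    and const: "c \<ge> 0 \<Longrightarrow> [:c:] \<in> C"
begin

text \<open>The inequality |p| \<le> c at the generic point.\<close>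

definition bounded_by :: "rat \<Rightarrow> rat poly \<Rightarrow> bool" where
  "bounded_by c p \<longleftrightarrow> [:c:] + p \<in> C \<and> [:c:] - p \<in> C"

lemma bounded_by_const: "\<bar>a\<bar> \<le> c \<Longrightarrow> bounded_by c [:a:]"
  by (auto simp: bounded_by_def intro!: const)

lemma bounded_by_add:
  assumes "bounded_by c p" "bounded_by d q"
  shows "bounded_by (c + d) (p + q)"
proof -
  have "[:c + d:] + (p + q) = ([:c:] + p) + ([:d:] + q)" "[:c + d:] - (p + q) = ([:c:] - p) + ([:d:] - q)"
    by (simp_all add: algebra_simps)
  then show ?thesis using assms add unfolding bounded_by_def by metis
qed

text \<open>Rests on 2 (c d + p q) = (c + p) (d + q) + (c - p) (d - q) and its analogue with q
  negated; the factor 1/2 is a nonnegative constant and hence lies in the cone.\<close>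

lemma bounded_by_mult:
  assumes "bounded_by c p" "bounded_by d q"
  shows "bounded_by (c * d) (p * q)"
proof -
  have half: "[:1 / 2:] \<in> C" by (rule const) simp
  have *: "[:c * d:] = [:c:] * [:d:]" by simp
  have h2: "[:1 / 2:] * (r + r) = r" for r :: "rat poly"
  proof -
    have "[:1 / 2:] * (r + r) = ([:1 / 2:] + [:1 / 2:]) * r" by (simp only: distrib_left distrib_right)
    then show ?thesis by simp
  qed
  have "[:c * d:] + p * q = [:1 / 2:] * (([:c:] + p) * ([:d:] + q) + ([:c:] - p) * ([:d:] - q))"
    unfolding * by (subst h2[symmetric]) (simp only: algebra_simps)
  moreover have "[:c * d:] - p * q = [:1 / 2:] * (([:c:] + p) * ([:d:] - q) + ([:c:] - p) * ([:d:] + q))"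
    unfolding * by (subst h2[symmetric]) (simp only: algebra_simps)
  ultimately show ?thesis using assms half add mult unfolding bounded_by_def by metis
qed

lemma bounded_by_mono:
  assumes "bounded_by c p" "c \<le> d"
  shows "bounded_by d p"
proof -
  have "bounded_by (c + (d - c)) (p + [:0:])"
    using assms by (intro bounded_by_add bounded_by_const) auto
  then show ?thesis by simp
qed

lemma sign_of_perturbation:
  assumes p: "p \<noteq> 0" and bound: "bounded_by c (p - [:v:])" and v: "c < \<bar>v\<bar>"
  shows "p \<in> C \<longleftrightarrow> v > 0"
proof (cases "v > 0")
  case True
  have "p = ([:c:] + (p - [:v:])) + [:v - c:]" by (simp add: algebra_simps)
  moreover have "[:v - c:] \<in> C" using v True by (intro const) auto
  ultimately have "p \<in> C" using bound add unfolding bounded_by_def by metis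
  then show ?thesis using True by simp
next
  case False
  have "- p = ([:c:] - (p - [:v:])) + [:- v - c:]" by (simp add: algebra_simps)
  moreover have "[:- v - c:] \<in> C" using v False by (intro const) auto
  ultimately have "- p \<in> C" using bound add unfolding bounded_by_def by metis
  then show ?thesis using False antisym p by blast
qed

lemma sign_if_bounded_below:
  assumes p: "p \<noteq> 0" and \<epsilon>: "\<epsilon> \<ge> 0" and \<sigma>: "\<sigma> = 1 \<or> \<sigma> = -1" and "smult \<sigma> p - [:\<epsilon>:] \<in> C"
  shows "p \<in> C \<longleftrightarrow> \<sigma> = 1"
proof -
  have "smult \<sigma> p = (smult \<sigma> p - [:\<epsilon>:]) + [:\<epsilon>:]" by simp
  then have "smult \<sigma> p \<in> C" using assms(4) add const[OF \<epsilon>] by metis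
  then show ?thesis using \<sigma> antisym[of p] p by auto
qed

end

section \<open>Estimates that are uniform in the ordering\<close>

lemma poly_bound_on_interval: "\<exists>B. \<forall>r. \<bar>r\<bar> \<le> M \<longrightarrow> \<bar>poly p r\<bar> \<le> (B :: rat)"
proof (induction p)
  case (pCons a p)
  then obtain B where B: "\<And>r. \<bar>r\<bar> \<le> M \<Longrightarrow> \<bar>poly p r\<bar> \<le> B" by blast
  have "\<bar>poly (pCons a p) r\<bar> \<le> \<bar>a\<bar> + M * B" if r: "\<bar>r\<bar> \<le> M" for r
  proof -
    have "\<bar>poly (pCons a p) r\<bar> \<le> \<bar>a\<bar> + \<bar>r\<bar> * \<bar>poly p r\<bar>"
      using abs_triangle_ineq[of a "r * poly p r"] by (simp add: abs_mult)
    also have "\<bar>r\<bar> * \<bar>poly p r\<bar> \<le> M * B" using r B[OF r] by (intro mult_mono) auto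
    finally show ?thesis by simp
  qed
  then show ?case by blast
qed auto

text \<open>With X the generic point, a + X p minus its value at r is X (p - p(r)) + (X - r) p(r),
  which gives the recursion \<open>M * L + B\<close> for the constant. It depends on p and M only,
  because the mesh width has to be fixed before the ordering and the mesh point are known.\<close>

lemma poly_lipschitz:
  "\<exists>L. \<forall>C r h. polynomial_cone C \<longrightarrow> polynomial_cone.bounded_by C M [:0, 1:] \<longrightarrow> \<bar>r\<bar> \<le> M \<longrightarrow>
     polynomial_cone.bounded_by C h [:- r, 1:] \<longrightarrow>
     polynomial_cone.bounded_by C (L * h) (p - [:poly p r:])"
proof (induction p)
  case 0
  show ?case
    by (intro exI[of _ 0]) (auto intro: polynomial_cone.bounded_by_const[of _ 0 0, simplified])
next
  case (pCons a p)
  then obtain L where L: "\<And>C r h. \<lbrakk>polynomial_cone C; polynomial_cone.bounded_by C M [:0, 1:]; \<bar>r\<bar> \<le> M;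
      polynomial_cone.bounded_by C h [:- r, 1:]\<rbrakk> \<Longrightarrow> polynomial_cone.bounded_by C (L * h) (p - [:poly p r:])"
    by blast
  obtain B where B: "\<And>r. \<bar>r\<bar> \<le> M \<Longrightarrow> \<bar>poly p r\<bar> \<le> B" using poly_bound_on_interval by blast
  have "polynomial_cone.bounded_by C ((M * L + B) * h) (pCons a p - [:poly (pCons a p) r:])"
    if C: "polynomial_cone C" and M: "polynomial_cone.bounded_by C M [:0, 1:]" and r: "\<bar>r\<bar> \<le> M"
      and h: "polynomial_cone.bounded_by C h [:- r, 1:]" for C r h
  proof -
    interpret polynomial_cone C by (rule C)
    have "pCons a p = [:a:] + [:0, 1:] * p" by simp
    then have "pCons a p - [:poly (pCons a p) r:] = [:0, 1:] * (p - [:poly p r:]) + [:- r, 1:] * [:poly p r:]"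
      by (simp add: algebra_simps)
    moreover have "bounded_by (M * (L * h) + h * B) ([:0, 1:] * (p - [:poly p r:]) + [:- r, 1:] * [:poly p r:])"
      using M L[OF C M r h] h B[OF r] by (intro bounded_by_add bounded_by_mult bounded_by_const)
    ultimately show ?thesis by (simp add: algebra_simps)
  qed
  then show ?case by blast
qed

text \<open>A positive lower bound instead of a mere sign keeps the Horner induction going: in a + X
  p the part \<open>\<epsilon>\<close> X eventually outweighs the constant a.\<close>

lemma constant_sign_at_top:
  "p \<noteq> 0 \<Longrightarrow> \<exists>M \<epsilon> \<sigma>. \<epsilon> > 0 \<and> (\<sigma> = 1 \<or> \<sigma> = -1) \<and>
     (\<forall>C. polynomial_cone C \<longrightarrow> [:- M, 1:] \<in> C \<longrightarrow> smult \<sigma> p - [:\<epsilon>:] \<in> C)"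
proof (induction p)
  case (pCons a p)
  show ?case
  proof (cases "p = 0")
    case True
    then have a: "a \<noteq> 0" using pCons by simp
    have "smult (sgn a) (pCons a p) - [:\<bar>a\<bar>:] = [:0:]" using True a by (simp add: sgn_if)
    then have "\<forall>C. polynomial_cone C \<longrightarrow> [:- 0, 1:] \<in> C \<longrightarrow> smult (sgn a) (pCons a p) - [:\<bar>a\<bar>:] \<in> C"
      using polynomial_cone.const[OF _ order_refl] by metis
    moreover have "\<bar>a\<bar> > 0" "sgn a = 1 \<or> sgn a = -1" using a by (auto simp: sgn_if)
    ultimately show ?thesis by blast
  next
    case False
    then obtain M \<epsilon> \<sigma> where IH: "\<epsilon> > 0" "\<sigma> = 1 \<or> \<sigma> = -1"
      "\<And>C. \<lbrakk>polynomial_cone C; [:- M, 1:] \<in> C\<rbrakk> \<Longrightarrow> smult \<sigma> p - [:\<epsilon>:] \<in> C"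
      using pCons.IH by blast
    \<comment> \<open>For X \<ge> N the product of \<open>\<epsilon>\<close> and X is at least |a| +
      1, which leaves 1 as the new lower bound; the maximum with M makes the induction hypothesis
      applicable.\<close>
    define N where "N = max M ((\<bar>a\<bar> + 1) / \<epsilon>)"
    have N: "M \<le> N" "(\<bar>a\<bar> + 1) / \<epsilon> \<le> N" "0 \<le> N"
      using IH(1) by (auto simp: N_def le_max_iff_disj)
    have "smult \<sigma> (pCons a p) - [:1:] \<in> C" if C: "polynomial_cone C" and X: "[:- N, 1:] \<in> C" for C
    proof -
      interpret polynomial_cone C by (rule C)
      have shift: "[:- c, 1:] \<in> C" if "c \<le> N" for c
        using add[OF X const[of "N - c"]] that by simp
      have 1: "[:0, 1:] * (smult \<sigma> p - [:\<epsilon>:]) \<in> C"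
        using mult[OF shift[OF N(3)] IH(3)[OF C shift[OF N(1)]]] by simp
      have 2: "[:\<epsilon>:] * [:- ((\<bar>a\<bar> + 1) / \<epsilon>), 1:] \<in> C"
        using IH(1) by (intro mult[OF const shift[OF N(2)]]) simp
      have 3: "[:\<sigma> * a + \<bar>a\<bar>:] \<in> C"
        using IH(2) by (intro const) auto
      have "smult \<sigma> (pCons a p) - [:1:] =
          [:0, 1:] * (smult \<sigma> p - [:\<epsilon>:]) + [:\<epsilon>:] * [:- ((\<bar>a\<bar> + 1) / \<epsilon>), 1:] + [:\<sigma> * a + \<bar>a\<bar>:]"
        using IH(1) by (simp add: algebra_simps)
      then show ?thesis using add[OF add[OF 1 2] 3] by (simp only:)
    qed
    then show ?thesis using IH(2) by (intro exI[of _ N] exI[of _ 1] exI[of _ \<sigma>]) simp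
  qed
qed simp

lemma pcompose_reflect_eq_0: "pcompose p [:0, - 1 :: rat:] = 0 \<longleftrightarrow> p = 0"
  by (rule pcompose_eq_0_iff) simp

text \<open>The substitution of -x for x exchanges the two ends of the line, so the lower end needs
  no second induction.\<close>

lemma polynomial_cone_reflect:
  assumes "polynomial_cone C"
  shows "polynomial_cone {p. pcompose p [:0, -1:] \<in> C}"
proof -
  interpret polynomial_cone C by fact
  show ?thesis
  proof
    fix p q :: "rat poly" and c :: rat
    assume *: "p \<in> {p. pcompose p [:0, -1:] \<in> C}"
    show "q \<in> {p. pcompose p [:0, -1:] \<in> C} \<Longrightarrow> p + q \<in> {p. pcompose p [:0, -1:] \<in> C}"
      using * add by (simp add: pcompose_add)
    show "q \<in> {p. pcompose p [:0, -1:] \<in> C} \<Longrightarrow> p * q \<in> {p. pcompose p [:0, -1:] \<in> C}"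
      using * mult by (simp add: pcompose_mult)
    show "- p \<in> {p. pcompose p [:0, -1:] \<in> C} \<Longrightarrow> p = 0"
      using * antisym[of "pcompose p [:0, -1:]"] by (simp add: pcompose_uminus pcompose_reflect_eq_0)
  next
    fix p :: "rat poly"
    show "p \<in> {p. pcompose p [:0, -1:] \<in> C} \<or> - p \<in> {p. pcompose p [:0, -1:] \<in> C}"
      using total by (simp add: pcompose_uminus)
  next
    fix c :: rat assume "c \<ge> 0"
    then show "[:c:] \<in> {p. pcompose p [:0, -1:] \<in> C}" using const by (simp add: pcompose_const)
  qed
qed

text \<open>The lower end is the upper end for the reflected polynomial;
  \<open>[:- N, -1:] \<in> C\<close> says x \<le> -N. Admitting every larger N allows the radius of
  the mesh to be at least 1.\<close>

lemma constant_sign_at_ends: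
  assumes p: "p \<noteq> 0"
  shows "\<exists>M. \<forall>N\<ge>M. \<exists>\<sigma> \<tau>. (\<forall>C. polynomial_cone C \<longrightarrow> [:- N, 1:] \<in> C \<longrightarrow> (p \<in> C \<longleftrightarrow> \<sigma>)) \<and>
     (\<forall>C. polynomial_cone C \<longrightarrow> [:- N, -1:] \<in> C \<longrightarrow> (p \<in> C \<longleftrightarrow> \<tau>))"
proof -
  obtain M \<epsilon> \<sigma> where M: "\<epsilon> > 0" "\<sigma> = 1 \<or> \<sigma> = -1"
    "\<And>C. \<lbrakk>polynomial_cone C; [:- M, 1:] \<in> C\<rbrakk> \<Longrightarrow> smult \<sigma> p - [:\<epsilon>:] \<in> C"
    using constant_sign_at_top[OF p] by blast
  let ?q = "pcompose p [:0, -1:]"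
  have q: "?q \<noteq> 0" using p by (simp add: pcompose_reflect_eq_0)
  have qq: "pcompose ?q [:0, -1:] = p" by (simp add: pcompose_assoc[symmetric] pcompose_pCons)
  obtain M' \<epsilon>' \<tau> where M': "\<epsilon>' > 0" "\<tau> = 1 \<or> \<tau> = -1"
    "\<And>C. \<lbrakk>polynomial_cone C; [:- M', 1:] \<in> C\<rbrakk> \<Longrightarrow> smult \<tau> ?q - [:\<epsilon>':] \<in> C"
    using constant_sign_at_top[OF q] by blast
  have top: "p \<in> C \<longleftrightarrow> \<sigma> = 1" if C: "polynomial_cone C" and "M \<le> N" "[:- N, 1:] \<in> C" for C N
  proof -
    interpret polynomial_cone C by (rule C)
    have "[:- M, 1:] \<in> C" using add[OF that(3) const[of "N - M"]] that by simp
    then show ?thesis by (rule sign_if_bounded_below[OF p less_imp_le[OF M(1)] M(2) M(3)[OF C]])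
  qed
  have bot: "p \<in> C \<longleftrightarrow> \<tau> = 1" if C: "polynomial_cone C" and "M' \<le> N" "[:- N, -1:] \<in> C" for C N
  proof -
    interpret polynomial_cone C by (rule C)
    have "[:- M', -1:] \<in> C" using add[OF that(3) const[of "N - M'"]] that by simp
    then have "smult \<tau> p - [:\<epsilon>':] \<in> C"
      using M'(3)[OF polynomial_cone_reflect[OF C]]
      by (simp add: pcompose_pCons pcompose_diff pcompose_smult qq)
    then show ?thesis by (rule sign_if_bounded_below[OF p less_imp_le[OF M'(1)] M'(2)])
  qed
  show ?thesis
  proof (intro exI[of _ "max M M'"] allI impI)
    fix N assume "max M M' \<le> N"
    then show "\<exists>\<sigma> \<tau>. (\<forall>C. polynomial_cone C \<longrightarrow> [:- N, 1:] \<in> C \<longrightarrow> (p \<in> C \<longleftrightarrow> \<sigma>)) \<and>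
     (\<forall>C. polynomial_cone C \<longrightarrow> [:- N, -1:] \<in> C \<longrightarrow> (p \<in> C \<longleftrightarrow> \<tau>))"
      using top bot by (intro exI[of _ "\<sigma> = 1"] exI[of _ "\<tau> = 1"]) auto
  qed
qed

text \<open>The points of Q below the generic point, as \<open>[:- q, 1:]\<close> is x - q.\<close>

definition rational_cut :: "rat set \<Rightarrow> rat poly set \<Rightarrow> rat set" where
  "rational_cut Q C = {q \<in> Q. [:- q, 1:] \<in> C}"

text \<open>In a Bezout identity u p + v q = 1 with |u| and |v| at most D on the interval, |p| and
  |q| cannot both be below 1 / (2 D).\<close>

lemma coprime_bounded_below:
  fixes p q :: "rat poly"
  assumes "coprime p q"
  shows "\<exists>\<epsilon>>0. \<forall>r. \<bar>r\<bar> \<le> M \<longrightarrow> \<epsilon> \<le> \<bar>poly p r\<bar> \<or> \<epsilon> \<le> \<bar>poly q r\<bar>"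
proof -
  obtain u v where uv: "u * p + v * q = 1"
    using assms bezout_coefficients_fst_snd[of p q] by (metis coprime_iff_gcd_eq_1)
  obtain B where B: "\<And>r. \<bar>r\<bar> \<le> M \<Longrightarrow> \<bar>poly u r\<bar> \<le> B" using poly_bound_on_interval by blast
  obtain B' where B': "\<And>r. \<bar>r\<bar> \<le> M \<Longrightarrow> \<bar>poly v r\<bar> \<le> B'" using poly_bound_on_interval by blast
  define D where "D = max 1 (max B B')"
  have D: "D > 0" "B \<le> D" "B' \<le> D" by (auto simp: D_def)
  have "1 / (2 * D) \<le> \<bar>poly p r\<bar> \<or> 1 / (2 * D) \<le> \<bar>poly q r\<bar>" if r: "\<bar>r\<bar> \<le> M" for r
  proof (rule ccontr)
    assume "\<not> ?thesis"
    then have lt: "\<bar>poly p r\<bar> < 1 / (2 * D)" "\<bar>poly q r\<bar> < 1 / (2 * D)" by auto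
    have "1 = \<bar>poly u r * poly p r + poly v r * poly q r\<bar>"
      using arg_cong[OF uv, of "\<lambda>f. poly f r"] by simp
    also have "\<dots> \<le> \<bar>poly u r\<bar> * \<bar>poly p r\<bar> + \<bar>poly v r\<bar> * \<bar>poly q r\<bar>"
      by (metis abs_mult abs_triangle_ineq)
    also have "\<dots> \<le> D * \<bar>poly p r\<bar> + D * \<bar>poly q r\<bar>"
      using B[OF r] B'[OF r] D by (intro add_mono mult_right_mono) auto
    also have "\<dots> < D * (1 / (2 * D)) + D * (1 / (2 * D))"
      using lt D by (intro add_strict_mono mult_strict_left_mono)
    also have "\<dots> = 1" using D by simp
    finally show False by simp
  qed
  then show ?thesis using D by (intro exI[of _ "1 / (2 * D)"]) auto
qed

text \<open>
  Between adjacent points of a fine rational mesh, one of \<open>p\<close> and \<open>q\<close> has absolute value at the left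
  end point exceeding its variation (Bezout and a Lipschitz bound), so it keeps its sign; no real
  roots are needed.
\<close>

lemma coprime_separation:
  fixes p q :: "rat poly"
  assumes pq: "coprime p q" "p \<noteq> 0" "q \<noteq> 0"
  obtains Q where "finite Q"
    "\<And>C. polynomial_cone C \<Longrightarrow>
      (\<forall>C'. polynomial_cone C' \<longrightarrow> rational_cut Q C' = rational_cut Q C \<longrightarrow> (p \<in> C' \<longleftrightarrow> p \<in> C)) \<or>
      (\<forall>C'. polynomial_cone C' \<longrightarrow> rational_cut Q C' = rational_cut Q C \<longrightarrow> (q \<in> C' \<longleftrightarrow> q \<in> C))"
proof -
  obtain M\<^sub>0 where M0: "\<And>N. M\<^sub>0 \<le> N \<Longrightarrow> \<exists>\<sigma> \<tau>. (\<forall>C. polynomial_cone C \<longrightarrow> [:- N, 1:] \<in> C \<longrightarrow> (p \<in> C \<longleftrightarrow> \<sigma>)) \<and>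
     (\<forall>C. polynomial_cone C \<longrightarrow> [:- N, -1:] \<in> C \<longrightarrow> (p \<in> C \<longleftrightarrow> \<tau>))"
    using constant_sign_at_ends[OF pq(2)] by blast
  define M where "M = max M\<^sub>0 1"
  obtain \<sigma> \<tau> where \<sigma>: "\<And>C. \<lbrakk>polynomial_cone C; [:- M, 1:] \<in> C\<rbrakk> \<Longrightarrow> p \<in> C \<longleftrightarrow> \<sigma>"
    and \<tau>: "\<And>C. \<lbrakk>polynomial_cone C; [:- M, -1:] \<in> C\<rbrakk> \<Longrightarrow> p \<in> C \<longleftrightarrow> \<tau>"
    using M0[of M] by (auto simp: M_def)
  have M: "M \<ge> 1" by (simp add: M_def)
  obtain \<epsilon> where \<epsilon>: "\<epsilon> > 0" "\<And>r. \<bar>r\<bar> \<le> M + 1 \<Longrightarrow> \<epsilon> \<le> \<bar>poly p r\<bar> \<or> \<epsilon> \<le> \<bar>poly q r\<bar>"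
    using coprime_bounded_below[OF pq(1)] by blast
  \<comment> \<open>The radius \<open>M + 1\<close> leaves room for the generic point, which lies
    within a mesh width of at most 1 of a mesh point of absolute value at most M.\<close>
  define lip where "lip f L \<longleftrightarrow> (\<forall>C r h. polynomial_cone C \<longrightarrow> polynomial_cone.bounded_by C (M + 1) [:0, 1:] \<longrightarrow>
     \<bar>r\<bar> \<le> M + 1 \<longrightarrow> polynomial_cone.bounded_by C h [:- r, 1:] \<longrightarrow>
     polynomial_cone.bounded_by C (L * h) (f - [:poly f r:]))" for f L
  obtain L\<^sub>p where Lp: "lip p L\<^sub>p" using poly_lipschitz unfolding lip_def by blast
  obtain L\<^sub>q where Lq: "lip q L\<^sub>q" using poly_lipschitz unfolding lip_def by blast
  define L where "L = max 1 (max L\<^sub>p L\<^sub>q)"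
  have L: "L \<ge> 1" "L\<^sub>p \<le> L" "L\<^sub>q \<le> L" by (auto simp: L_def)
  \<comment> \<open>The summand 1 makes the mesh width at most 1; the summand
    \<open>L / \<epsilon>\<close> makes the variation \<open>L * h\<close> within a cell smaller
    than \<open>\<epsilon>\<close>.\<close>
  obtain n :: nat where n: "2 * M * (1 + L / \<epsilon>) < of_nat n" using reals_Archimedean2 by blast
  define h where "h = 2 * M / of_nat n"
  define r where "r k = - M + of_nat k * h" for k :: nat
  have "0 < 2 * M * (1 + L / \<epsilon>)" using M L \<epsilon>(1) by (intro mult_pos_pos add_pos_nonneg) auto
  then have n0: "of_nat n > (0 :: rat)" using n by linarith
  have h0: "h > 0" using M n0 by (simp add: h_def)
  have "2 * M * 1 \<le> 2 * M * (1 + L / \<epsilon>)"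
    using M L \<epsilon>(1) by (intro mult_left_mono) auto
  then have h1: "h \<le> 1" using n n0 by (simp add: h_def)
  have "2 * M * (L / \<epsilon>) \<le> 2 * M * (1 + L / \<epsilon>)" using M by (intro mult_left_mono) auto
  then have "2 * M * (L / \<epsilon>) < of_nat n" using n by linarith
  then have hL: "L * h < \<epsilon>" using n0 \<epsilon>(1) by (simp add: h_def field_simps)
  have rn: "r n = M" and r0: "r 0 = - M" using n0 by (simp_all add: r_def h_def)
  have mesh_le: "\<bar>r k\<bar> \<le> M" if "k \<le> n" for k
  proof -
    have "of_nat k * h \<le> of_nat n * h" using that h0 by simp
    then have "r k \<le> M" using n0 by (simp add: r_def h_def)
    moreover have "0 \<le> of_nat k * h" using h0 by simp
    then have "- M \<le> r k" by (simp add: r_def)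
    ultimately show ?thesis by simp
  qed
  have fixed_sign: "(f \<in> C \<longleftrightarrow> poly f (r k) > 0)"
    if f: "f \<noteq> 0" "lip f L'" "L' \<le> L" "\<epsilon> \<le> \<bar>poly f (r k)\<bar>"
      and C: "polynomial_cone C" "[:- r k, 1:] \<in> C" "[:- r (Suc k), 1:] \<notin> C"
      and k: "k < n" for f L' k C
  proof -
    interpret polynomial_cone C by (rule C)
    have rk: "\<bar>r k\<bar> \<le> M" using mesh_le k by simp
    have "[:r (Suc k), -1:] \<in> C" using total[of "[:- r (Suc k), 1:]"] C(3) by simp
    moreover have "[:r (Suc k), -1:] = [:h:] - [:- r k, 1:]" by (simp add: r_def algebra_simps)
    moreover have "[:h:] + [:- r k, 1:] \<in> C" using add[OF const C(2)] h0 by simp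
    ultimately have b: "bounded_by h [:- r k, 1:]" by (simp add: bounded_by_def)
    have "bounded_by (h + M) ([:- r k, 1:] + [:r k:])"
      using b rk by (intro bounded_by_add bounded_by_const) auto
    then have "bounded_by (M + 1) [:0, 1:]" using h1 by (auto intro: bounded_by_mono)
    then have "bounded_by (L' * h) (f - [:poly f (r k):])"
      using f(2) C(1) b rk unfolding lip_def by (meson add_increasing2 order_trans le_add_same_cancel1 zero_le_one)
    moreover have "L' * h \<le> L * h" using f(3) h0 by simp
    then have "L' * h < \<bar>poly f (r k)\<bar>" using f(4) hL by linarith
    ultimately show ?thesis using sign_of_perturbation f(1) by blast
  qed
  let ?Q = "r ` {..n}"
  have cutD: "[:- r k, 1:] \<in> C' \<longleftrightarrow> [:- r k, 1:] \<in> C" if "rational_cut ?Q C' = rational_cut ?Q C" "k \<le> n" for C C' k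
    using that by (auto simp: rational_cut_def set_eq_iff)
  have "(\<forall>C'. polynomial_cone C' \<longrightarrow> rational_cut ?Q C' = rational_cut ?Q C \<longrightarrow> (p \<in> C' \<longleftrightarrow> p \<in> C)) \<or>
      (\<forall>C'. polynomial_cone C' \<longrightarrow> rational_cut ?Q C' = rational_cut ?Q C \<longrightarrow> (q \<in> C' \<longleftrightarrow> q \<in> C))"
    if C: "polynomial_cone C" for C
  proof -
    \<comment> \<open>Beyond either end of the mesh p has constant sign. Otherwise the generic point
      lies in a cell between \<open>r k\<close> and \<open>r (Suc k)\<close>, and the polynomial
      that is large at \<open>r k\<close> keeps its sign there.\<close>
    consider "[:- r 0, 1:] \<notin> C" | "[:- r n, 1:] \<in> C" | "[:- r 0, 1:] \<in> C" "[:- r n, 1:] \<notin> C" by blast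
    then show ?thesis
    proof cases
      case 1
      have "p \<in> C' \<longleftrightarrow> \<tau>" if C': "polynomial_cone C'" "rational_cut ?Q C' = rational_cut ?Q C" for C'
      proof -
        have "[:- r 0, 1:] \<notin> C'" using cutD[OF C'(2), of 0] 1 by simp
        then have "[:- M, -1:] \<in> C'" using polynomial_cone.total[OF C'(1), of "[:- r 0, 1:]"] by (simp add: r0)
        then show ?thesis by (rule \<tau>[OF C'(1)])
      qed
      then show ?thesis using C by blast
    next
      case 2
      have "p \<in> C' \<longleftrightarrow> \<sigma>" if C': "polynomial_cone C'" "rational_cut ?Q C' = rational_cut ?Q C" for C'
        using cutD[OF C'(2), of n] 2 \<sigma>[OF C'(1)] by (simp add: rn)
      then show ?thesis using C by blast
    next
      case 3
      then obtain k where k: "k < n" "[:- r k, 1:] \<in> C" "[:- r (Suc k), 1:] \<notin> C"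
        using ex_least_nat_less[of "\<lambda>k. [:- r k, 1:] \<notin> C" n] by blast
      have gap: "[:- r k, 1:] \<in> C'" "[:- r (Suc k), 1:] \<notin> C'" if "rational_cut ?Q C' = rational_cut ?Q C" for C'
        using cutD[OF that, of k] cutD[OF that, of "Suc k"] k by auto
      have "\<bar>r k\<bar> \<le> M + 1" using mesh_le[of k] k(1) by simp
      then consider "\<epsilon> \<le> \<bar>poly p (r k)\<bar>" | "\<epsilon> \<le> \<bar>poly q (r k)\<bar>" using \<epsilon>(2) by blast
      then show ?thesis
      proof cases
        case 1
        have "p \<in> C' \<longleftrightarrow> p \<in> C" if "polynomial_cone C'" "rational_cut ?Q C' = rational_cut ?Q C" for C'
          using fixed_sign[OF pq(2) Lp L(2) 1 that(1) gap[OF that(2)] k(1)]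
            fixed_sign[OF pq(2) Lp L(2) 1 C k(2,3,1)] by simp
        then show ?thesis by blast
      next
        case 2
        have "q \<in> C' \<longleftrightarrow> q \<in> C" if "polynomial_cone C'" "rational_cut ?Q C' = rational_cut ?Q C" for C'
          using fixed_sign[OF pq(3) Lq L(3) 2 that(1) gap[OF that(2)] k(1)]
            fixed_sign[OF pq(3) Lq L(3) 2 C k(2,3,1)] by simp
        then show ?thesis by blast
      qed
    qed
  qed
  then show ?thesis using that[of ?Q] by blast
qed

section \<open>Orderings and characters of a field\<close>

text \<open>Zero lies in every ordering and so receives the sign 1; the laws for negatives and
  products therefore ask for nonzero arguments.\<close>

definition ordering_sign :: "'k::field \<Rightarrow> 'k set \<Rightarrow> int" where
  "ordering_sign a P = (if a \<in> P then 1 else -1)"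

lemma field_sign_group_ordering_sign:
  "field_sign_group = {restrict (ordering_sign a) field_orderings | a :: 'k::field. a \<noteq> 0}"
  unfolding field_sign_group_eq ordering_sign_def ..

context
  fixes P :: "'k::field set"
  assumes P: "P \<in> field_orderings"
begin

lemma ordering_add: "\<lbrakk>a \<in> P; b \<in> P\<rbrakk> \<Longrightarrow> a + b \<in> P"
  and ordering_mult: "\<lbrakk>a \<in> P; b \<in> P\<rbrakk> \<Longrightarrow> a * b \<in> P"
  using P by (simp_all add: field_orderings_def is_field_ordering_def)

lemma ordering_total: "a \<in> P \<or> - a \<in> P"
proof -
  have "a \<in> P \<union> uminus ` P" using P by (simp add: field_orderings_def is_field_ordering_def)
  then show ?thesis by auto
qed

lemma ordering_zero: "0 \<in> P"
  using ordering_total[of 0] by simp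

lemma ordering_antisym:
  assumes "a \<in> P" "- a \<in> P"
  shows "a = 0"
proof -
  have "a \<in> P \<inter> uminus ` P" using assms by (metis IntI image_eqI minus_minus)
  moreover have "P \<inter> uminus ` P = {0}" using P by (simp add: field_orderings_def is_field_ordering_def)
  ultimately show ?thesis by blast
qed

lemma ordering_square: "a * a \<in> P"
  using ordering_total[of a] ordering_mult[of a a] ordering_mult[of "- a" "- a"] by auto

lemma ordering_sign_minus: "a \<noteq> 0 \<Longrightarrow> ordering_sign (- a) P = - ordering_sign a P"
  using ordering_total[of a] ordering_antisym[of a] by (auto simp: ordering_sign_def)

lemma ordering_sign_mult:
  assumes "a \<noteq> 0" "b \<noteq> 0"
  shows "ordering_sign (a * b) P = ordering_sign a P * ordering_sign b P"
proof -
  have pos: "ordering_sign (a * b) P = 1" if "a \<in> P" "b \<in> P" for a b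
    using ordering_mult[OF that] by (simp add: ordering_sign_def)
  consider "a \<in> P" "b \<in> P" | "a \<in> P" "- b \<in> P" | "- a \<in> P" "b \<in> P" | "- a \<in> P" "- b \<in> P"
    using ordering_total[of a] ordering_total[of b] by blast
  then show ?thesis
  proof cases
    case 1
    then show ?thesis using pos[OF 1] by (simp add: ordering_sign_def)
  next
    case 2
    then show ?thesis
      using pos[OF 2] ordering_sign_minus[of "a * b"] ordering_sign_minus[of b] assms
      by (simp add: ordering_sign_def[of a] ordering_sign_def[of "- b"])
  next
    case 3
    then show ?thesis
      using pos[OF 3] ordering_sign_minus[of "a * b"] ordering_sign_minus[of a] assms
      by (simp add: ordering_sign_def[of b] ordering_sign_def[of "- a"])
  next
    case 4
    then show ?thesis
      using pos[OF 4] ordering_sign_minus[of a] ordering_sign_minus[of b] assms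
      by (simp add: ordering_sign_def[of "- b"] ordering_sign_def[of "- a"])
  qed
qed

lemma ordering_sign_one: "ordering_sign 1 P = 1"
  using ordering_square[of 1] by (simp add: ordering_sign_def)

lemma ordering_sign_prod_power:
  assumes "finite S" "\<And>i. i \<in> S \<Longrightarrow> g i \<noteq> 0"
  shows "ordering_sign (\<Prod>i\<in>S. g i ^ e i) P = (\<Prod>i\<in>S. ordering_sign (g i) P ^ e i)"
proof -
  have pow: "ordering_sign (a ^ n) P = ordering_sign a P ^ n" if "a \<noteq> 0" for a n
    using that by (induction n) (simp_all add: ordering_sign_one ordering_sign_mult)
  show ?thesis
    using assms by (induction S) (simp_all add: ordering_sign_one ordering_sign_mult pow)
qed

end

lemma field_sign_group_mult:
  assumes "f \<in> field_sign_group" "g \<in> field_sign_group"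
  shows "(\<lambda>P\<in>field_orderings. f P * g P) \<in> (field_sign_group :: ('k::field set \<Rightarrow> int) set)"
proof -
  obtain a b :: 'k where ab: "a \<noteq> 0" "b \<noteq> 0" "f = restrict (ordering_sign a) field_orderings"
    "g = restrict (ordering_sign b) field_orderings"
    using assms by (auto simp: field_sign_group_ordering_sign)
  then have "(\<lambda>P\<in>field_orderings. f P * g P) = restrict (ordering_sign (a * b)) field_orderings"
    by (auto simp: ordering_sign_mult)
  then show ?thesis using ab by (auto simp: field_sign_group_ordering_sign intro!: exI[of _ "a * b"])
qed

text \<open>The kernel of the character, lifted to the field and joined with 0, is an ordering:
  multiplicativity gives products, the value -1 at -1 gives totality and antisymmetry, and sums are
  covered because a + b lies in the value set of a and b.\<close>

lemma field_characters:
  fixes \<chi> :: "('k::field set \<Rightarrow> int) \<Rightarrow> int"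
  assumes sgn: "\<chi> \<in> field_sign_group \<rightarrow> {-1, 1}"
    and mult: "\<And>a b. \<lbrakk>a \<in> field_sign_group; b \<in> field_sign_group\<rbrakk> \<Longrightarrow>
      \<chi> (\<lambda>P\<in>field_orderings. a P * b P) = \<chi> a * \<chi> b"
    and neg: "\<chi> (\<lambda>P\<in>field_orderings. -1) = -1"
    and D: "\<And>a b c. \<lbrakk>a \<in> field_sign_group; b \<in> field_sign_group; \<chi> a = 1; \<chi> b = 1;
      c \<in> value_set field_orderings field_sign_group a b\<rbrakk> \<Longrightarrow> \<chi> c = 1"
  shows "\<exists>P\<in>field_orderings. \<forall>a\<in>field_sign_group. \<chi> a = a P"
proof -
  define s where "s a = restrict (ordering_sign a) field_orderings" for a :: 'k
  have sG: "s a \<in> field_sign_group" if "a \<noteq> 0" for a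
    using that by (auto simp: s_def field_sign_group_ordering_sign)
  have \<chi>_cases: "\<chi> (s a) \<in> {-1, 1}" if "a \<noteq> 0" for a using sgn sG[OF that] by blast
  have \<chi>_mult: "\<chi> (s (a * b)) = \<chi> (s a) * \<chi> (s b)" if ab: "a \<noteq> 0" "b \<noteq> 0" for a b
  proof -
    have "s (a * b) = (\<lambda>P\<in>field_orderings. s a P * s b P)"
      using ab by (auto simp: s_def ordering_sign_mult)
    then show ?thesis using mult[OF sG sG, OF ab] by simp
  qed
  have "s (- 1) = (\<lambda>P\<in>field_orderings. -1)"
    by (auto simp: s_def ordering_sign_minus ordering_sign_one)
  then have \<chi>_neg: "\<chi> (s (- a)) = - \<chi> (s a)" if "a \<noteq> 0" for a
    using \<chi>_mult[of "- 1" a] that neg by simp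
  define P where "P = {a. a = 0 \<or> \<chi> (s a) = 1}"
  have "P \<in> field_orderings"
    unfolding field_orderings_def is_field_ordering_def
  proof (intro CollectI conjI ballI)
    fix a b assume ab: "a \<in> P" "b \<in> P"
    then show "a * b \<in> P" using \<chi>_mult[of a b]
      by (cases "a = 0 \<or> b = 0") (auto simp: P_def)
    show "a + b \<in> P"
    proof (cases "a = 0 \<or> b = 0 \<or> a + b = 0")
      case True
      then show ?thesis using ab by (auto simp: P_def)
    next
      case False
      \<comment> \<open>If a and b have equal signs at Q, their sum shares it; if not, one of the
        two agrees with the sum whatever its sign is.\<close>
      have "s a Q = s (a + b) Q \<or> s b Q = s (a + b) Q" if Q: "Q \<in> field_orderings" for Q
      proof (cases "ordering_sign a Q = ordering_sign b Q")
        case True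
        consider "a \<in> Q" "b \<in> Q" | "- a \<in> Q" "- b \<in> Q"
          using True ordering_total[OF Q, of a] ordering_total[OF Q, of b]
          by (auto simp: ordering_sign_def split: if_splits)
        then have "ordering_sign a Q = ordering_sign (a + b) Q"
        proof cases
          case 1
          then show ?thesis using ordering_add[OF Q 1] by (simp add: ordering_sign_def)
        next
          case 2
          have "- (a + b) \<in> Q" using ordering_add[OF Q 2] by simp
          then show ?thesis
            using 2 ordering_sign_minus[OF Q, of a] ordering_sign_minus[OF Q, of "a + b"] False
            by (simp add: ordering_sign_def[of "- a"] ordering_sign_def[of "- (a + b)"] del: minus_add_distrib)
        qed
        then show ?thesis using Q by (simp add: s_def)
      next
        case F: False
        then show ?thesis using Q by (auto simp: s_def ordering_sign_def split: if_splits)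
      qed
      then have "s (a + b) \<in> value_set field_orderings field_sign_group (s a) (s b)"
        using sG False by (simp add: value_set_def)
      moreover have "\<chi> (s a) = 1" "\<chi> (s b) = 1" using ab False by (auto simp: P_def)
      ultimately have "\<chi> (s (a + b)) = 1" using D[OF sG sG] False by blast
      then show ?thesis by (simp add: P_def)
    qed
  next
    have "a \<in> P \<union> uminus ` P" for a
    proof (cases "a \<in> P")
      case False
      then have "a \<noteq> 0" "\<chi> (s a) = -1" using \<chi>_cases[of a] by (auto simp: P_def)
      then have "- a \<in> P" using \<chi>_neg by (simp add: P_def)
      then show ?thesis by (metis UnI2 image_eqI minus_minus)
    qed simp
    then show "P \<union> uminus ` P = UNIV" by blast
  next
    have "a = 0" if "a \<in> P" "- a \<in> P" for a
      using that \<chi>_neg[of a] by (cases "a = 0") (simp_all add: P_def)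
    moreover have "0 \<in> P" by (simp add: P_def)
    ultimately show "P \<inter> uminus ` P = {0}" by force
  qed
  moreover have "\<chi> f = f P" if f: "f \<in> field_sign_group" for f
  proof -
    obtain a where a: "a \<noteq> 0" "f = s a" using f by (auto simp: s_def field_sign_group_ordering_sign)
    have "\<chi> (s a) = ordering_sign a P" using \<chi>_cases[OF a(1)] a(1) by (auto simp: ordering_sign_def P_def)
    then show ?thesis using a \<open>P \<in> field_orderings\<close> by (simp add: s_def)
  qed
  ultimately show ?thesis by blast
qed

lemma field_sign_group_separates:
  assumes "P \<in> field_orderings" "Q \<in> field_orderings" "P \<noteq> Q"
  shows "\<exists>f\<in>field_sign_group. f P \<noteq> f (Q :: 'k::field set)"
proof -
  obtain a where a: "a \<in> P \<longleftrightarrow> a \<notin> Q" using assms(3) by blast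
  then have "a \<noteq> 0" using ordering_zero assms by blast
  then have "restrict (ordering_sign a) field_orderings \<in> field_sign_group"
    by (auto simp: field_sign_group_ordering_sign)
  moreover have "restrict (ordering_sign a) field_orderings P \<noteq> restrict (ordering_sign a) field_orderings Q"
    using a assms by (auto simp: ordering_sign_def)
  ultimately show ?thesis by blast
qed

text \<open>The order of the type class is itself an ordering; for rational functions it is the
  comparison by leading coefficients.\<close>

lemma field_orderings_nonempty: "(field_orderings :: 'k::linordered_field set set) \<noteq> {}"
proof -
  have "x \<in> {x. 0 \<le> x} \<union> uminus ` {x. 0 \<le> x}" for x :: 'k
  proof (cases "0 \<le> x")
    case False
    then have "- x \<in> {x. 0 \<le> x}" "x = - (- x)" by auto
    then show ?thesis by blast
  qed simp
  then have "{x :: 'k. 0 \<le> x} \<in> field_orderings"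
    by (auto simp: field_orderings_def is_field_ordering_def)
  then show ?thesis by blast
qed

section \<open>The field of rational functions\<close>

type_synonym rational_function = "rat poly fract"

text \<open>A nonnegative rational m / n is m n times the square of 1 / n, and natural numbers are
  sums of squares of 1.\<close>

lemma ordering_nonneg_const:
  assumes P: "P \<in> field_orderings" and c: "c \<ge> 0"
  shows "to_fract [:c:] \<in> (P :: rational_function set)"
proof -
  have nat: "to_fract [:of_nat n:] \<in> P" for n
  proof (induction n)
    case 0
    then show ?case using ordering_zero[OF P] by simp
  next
    case (Suc n)
    have "to_fract [:rat_of_nat (Suc n):] = to_fract [:of_nat n:] + 1"
      by (simp flip: to_fract_add to_fract_1 add: one_pCons)
    then show ?case using ordering_add[OF P Suc ordering_square[OF P, of 1]] by simp
  qed
  obtain m n where mn: "c = of_int m / of_int n" "n > 0"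
    by (metis quotient_of_div quotient_of_denom_pos surj_pair)
  then have "m \<ge> 0" using c by (simp add: zero_le_divide_iff)
  then have "c = of_nat (nat m) * of_nat (nat n) * (1 / of_nat (nat n)) * (1 / of_nat (nat n))"
    using mn by simp
  then have "to_fract [:c:] = to_fract [:of_nat (nat m):] * to_fract [:of_nat (nat n):] *
      (to_fract [:1 / of_nat (nat n):] * to_fract [:1 / of_nat (nat n):])"
    by (simp flip: to_fract_mult)
  then show ?thesis using ordering_mult[OF P ordering_mult[OF P nat nat] ordering_square[OF P]] by simp
qed

definition cone_of :: "rational_function set \<Rightarrow> rat poly set" where
  "cone_of P = {p. to_fract p \<in> P}"

lemma polynomial_cone_ordering:
  assumes P: "P \<in> field_orderings"
  shows "polynomial_cone (cone_of P)"
proof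
  show "p = 0" if "p \<in> cone_of P" "- p \<in> cone_of P" for p
    using ordering_antisym[OF P, of "to_fract p"] that by (simp add: cone_of_def)
qed (use ordering_add[OF P] ordering_mult[OF P] ordering_total[OF P] ordering_nonneg_const[OF P]
    in \<open>simp_all add: cone_of_def\<close>)

definition position :: "rat set \<Rightarrow> rational_function set \<Rightarrow> rat set" where
  "position Q P = rational_cut Q (cone_of P)"

definition poly_sign :: "rat poly \<Rightarrow> rational_function set \<Rightarrow> int" where
  "poly_sign p = ordering_sign (to_fract p)"

lemma poly_sign_eq_iff: "poly_sign p P = poly_sign p P' \<longleftrightarrow> (p \<in> cone_of P \<longleftrightarrow> p \<in> cone_of P')"
  by (auto simp: poly_sign_def ordering_sign_def cone_of_def)

lemma position_mono: "\<lbrakk>position Q P = position Q P'; R \<subseteq> Q\<rbrakk> \<Longrightarrow> position R P = position R P'"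
  by (auto simp: position_def rational_cut_def set_eq_iff)

definition separates :: "rat set \<Rightarrow> rat poly \<Rightarrow> rat poly \<Rightarrow> bool" where
  "separates Q p q \<longleftrightarrow> (\<forall>P\<in>field_orderings.
     (\<forall>P'\<in>field_orderings. position Q P' = position Q P \<longrightarrow> poly_sign p P' = poly_sign p P) \<or>
     (\<forall>P'\<in>field_orderings. position Q P' = position Q P \<longrightarrow> poly_sign q P' = poly_sign q P))"

lemma separates_mono: "\<lbrakk>separates Q p q; Q \<subseteq> R\<rbrakk> \<Longrightarrow> separates R p q"
  unfolding separates_def using position_mono by meson

text \<open>Primes are normalized, hence monic here, so distinct ones are not associates and
  therefore coprime.\<close>

lemma ex_separates:
  assumes "prime p" "prime q" "p \<noteq> q"
  shows "\<exists>Q. finite Q \<and> separates Q p q"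
proof -
  have "coprime p q" "p \<noteq> 0" "q \<noteq> 0" using assms primes_coprime by auto
  then obtain Q where Q: "finite Q" "\<And>C. polynomial_cone C \<Longrightarrow>
      (\<forall>C'. polynomial_cone C' \<longrightarrow> rational_cut Q C' = rational_cut Q C \<longrightarrow> (p \<in> C' \<longleftrightarrow> p \<in> C)) \<or>
      (\<forall>C'. polynomial_cone C' \<longrightarrow> rational_cut Q C' = rational_cut Q C \<longrightarrow> (q \<in> C' \<longleftrightarrow> q \<in> C))"
    by (rule coprime_separation) blast
  then have "separates Q p q"
    unfolding separates_def poly_sign_eq_iff position_def using polynomial_cone_ordering by metis
  then show ?thesis using Q(1) by blast
qed

section \<open>Admissible pairs and their finite groups\<close>

definition admissible :: "rat poly set \<Rightarrow> rat set \<Rightarrow> bool" where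
  "admissible S Q \<longleftrightarrow> finite S \<and> finite Q \<and> (\<forall>p\<in>S. prime p) \<and>
     (\<forall>p\<in>S. \<forall>q\<in>S. p \<noteq> q \<longrightarrow> separates Q p q)"

lemma block_space_admissible:
  assumes "admissible S Q"
  shows "block_space field_orderings (position Q) S poly_sign"
proof
  show "field_orderings \<noteq> ({} :: rational_function set set)" by (rule field_orderings_nonempty)
  have "position Q ` field_orderings \<subseteq> Pow Q" by (auto simp: position_def rational_cut_def)
  then show "finite (position Q ` field_orderings)"
    using assms finite_subset by (auto simp: admissible_def)
  show "finite S" using assms by (simp add: admissible_def)
  show "poly_sign p P \<in> {-1, 1}" for p P by (simp add: poly_sign_def ordering_sign_def)
  show "(\<forall>y\<in>field_orderings. position Q y = position Q x \<longrightarrow> poly_sign i y = poly_sign i x) \<or>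
       (\<forall>y\<in>field_orderings. position Q y = position Q x \<longrightarrow> poly_sign j y = poly_sign j x)"
    if "i \<in> S" "j \<in> S" "i \<noteq> j" "x \<in> field_orderings" for i j x
    using assms that unfolding admissible_def separates_def by blast
qed

text \<open>Separation survives a refinement of the cuts, so the cuts for the finitely many pairs of
  primes can be united with Q.\<close>

lemma admissible_extend:
  assumes S: "finite S" "\<And>p. p \<in> S \<Longrightarrow> prime p" and Q: "finite Q"
  obtains R where "Q \<subseteq> R" "admissible S R"
proof -
  obtain f where f: "\<And>p q. \<lbrakk>p \<in> S; q \<in> S; p \<noteq> q\<rbrakk> \<Longrightarrow> finite (f p q) \<and> separates (f p q) p q"
    using ex_separates S(2) by metis
  define R where "R = Q \<union> (\<Union>p\<in>S. \<Union>q\<in>S - {p}. f p q)"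
  have "finite R" using S(1) Q f by (auto simp: R_def)
  moreover have "separates R p q" if "p \<in> S" "q \<in> S" "p \<noteq> q" for p q
    using f[OF that] that by (elim conjE separates_mono) (auto simp: R_def)
  ultimately have "admissible S R" using S by (simp add: admissible_def)
  then show ?thesis using that[of R] by (simp add: R_def)
qed

abbreviation admissible_group :: "rat poly set \<Rightarrow> rat set \<Rightarrow> (rational_function set \<Rightarrow> int) set" where
  "admissible_group S Q \<equiv> block_group field_orderings (position Q) S poly_sign"

lemma admissible_group_mono:
  assumes "S \<subseteq> S'" "Q \<subseteq> Q'" "finite S'"
  shows "admissible_group S Q \<subseteq> admissible_group S' Q'"
proof
  fix f assume "f \<in> admissible_group S Q"
  then obtain e :: "rat poly \<Rightarrow> nat" where f: "f \<in> field_orderings \<rightarrow>\<^sub>E {-1, 1}"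
    and e: "blockwise (position Q) field_orderings (\<lambda>P. f P * (\<Prod>p\<in>S. poly_sign p P ^ e p))"
    by (auto simp: block_group_def)
  have eq: "(\<Prod>p\<in>S'. poly_sign p P ^ (if p \<in> S then e p else 0)) = (\<Prod>p\<in>S. poly_sign p P ^ e p)" for P
    using assms(1,3) by (intro prod.mono_neutral_cong_right) auto
  have "blockwise (position Q') field_orderings
      (\<lambda>P. f P * (\<Prod>p\<in>S'. poly_sign p P ^ (if p \<in> S then e p else 0)))"
    unfolding blockwise_def eq using blockwiseD[OF e] position_mono[OF _ assms(2)] by blast
  then show "f \<in> admissible_group S' Q'"
    unfolding block_group_def
    by (intro CollectI conjI f exI[of _ "\<lambda>p. if p \<in> S then e p else 0"])
qed

section \<open>Sign functions of the position as signs of linear polynomials\<close>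

lemma const_in_field_sign_group:
  assumes "c \<in> {-1, 1}"
  shows "(\<lambda>P\<in>field_orderings. c) \<in> (field_sign_group :: ('k::field set \<Rightarrow> int) set)"
proof -
  have "restrict (ordering_sign (1 :: 'k)) field_orderings = (\<lambda>P\<in>field_orderings. 1)"
    "restrict (ordering_sign (- 1 :: 'k)) field_orderings = (\<lambda>P\<in>field_orderings. -1)"
    by (auto simp: ordering_sign_minus ordering_sign_one)
  then have "(\<lambda>P\<in>field_orderings. 1) \<in> (field_sign_group :: ('k set \<Rightarrow> int) set)"
    "(\<lambda>P\<in>field_orderings. -1) \<in> (field_sign_group :: ('k set \<Rightarrow> int) set)"
    unfolding field_sign_group_ordering_sign by (metis (mono_tags, lifting) mem_Collect_eq neg_equal_0_iff_equal zero_neq_one)+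
  then show ?thesis using assms by auto
qed

lemma poly_sign_in_field_sign_group:
  "p \<noteq> 0 \<Longrightarrow> restrict (poly_sign p) field_orderings \<in> field_sign_group"
  by (auto simp: field_sign_group_ordering_sign poly_sign_def intro!: exI[of _ "to_fract p"])

lemma position_top:
  assumes P: "P \<in> field_orderings" and b: "[:- b, 1:] \<in> cone_of P" and A: "\<forall>a\<in>A. a < b"
  shows "position A P = A"
proof -
  interpret polynomial_cone "cone_of P" by (rule polynomial_cone_ordering[OF P])
  have "[:- a, 1:] \<in> cone_of P" if "a \<in> A" for a
    using add[OF b const[of "b - a"]] A that by (auto simp: less_imp_le)
  then show ?thesis by (auto simp: position_def rational_cut_def)
qed

text \<open>The positions of orderings are initial segments of Q and hence linearly ordered. A sign
  function of the position is determined up to a global sign by the cuts at which it jumps, and the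
  sign of b - x produces a jump at b alone. The induction removes the largest cut.\<close>

lemma blockwise_in_field_sign_group:
  assumes "finite Q" "f \<in> field_orderings \<rightarrow>\<^sub>E {-1, 1}" "blockwise (position Q) field_orderings f"
  shows "f \<in> field_sign_group"
  using assms
proof (induction Q arbitrary: f rule: finite_linorder_max_induct)
  case empty
  obtain P\<^sub>0 :: "rational_function set" where P0: "P\<^sub>0 \<in> field_orderings"
    using field_orderings_nonempty by blast
  have "f P = f P\<^sub>0" if "P \<in> field_orderings" for P
    by (rule blockwiseD[OF empty(2) that P0]) (simp add: position_def rational_cut_def)
  then have "f = (\<lambda>P\<in>field_orderings. f P\<^sub>0)"
    using empty(1) by (intro extensionalityI[of _ field_orderings]) (simp_all add: PiE_iff)
  then show ?case using const_in_field_sign_group[of "f P\<^sub>0"] empty(1) P0 by (metis PiE_mem)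
next
  case (insert b A)
  define T where "T = {P \<in> field_orderings. [:- b, 1:] \<in> cone_of P}"
  have top: "position A P = A" if "P \<in> T" for P
    using that insert.hyps(2) position_top unfolding T_def by blast
  have pos: "position (insert b A) P = (if P \<in> T then insert b A else position A P)"
    if "P \<in> field_orderings" for P
    using that top[of P] by (auto simp: T_def position_def rational_cut_def)
  have f: "f P \<in> {-1, 1}" if "P \<in> field_orderings" for P using insert.prems(1) that by blast
  \<comment> \<open>The value of f on the block just below b, or 1 if no ordering lies
    there.\<close>
  define c where "c = (if \<exists>P\<in>field_orderings - T. position A P = A
    then f (SOME P. P \<in> field_orderings - T \<and> position A P = A) else 1)"
  have c: "f P = c" if "P \<in> field_orderings - T" "position A P = A" for P
  proof -
    define R where "R = (SOME P. P \<in> field_orderings - T \<and> position A P = A)"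
    have R: "R \<in> field_orderings - T \<and> position A R = A"
      unfolding R_def by (rule someI[of _ P]) (use that in blast)
    then have "f P = f R"
      using that pos[of P] pos[of R] by (intro blockwiseD[OF insert.prems(2)]) auto
    then show ?thesis using that by (auto simp: c_def R_def)
  qed
  have c_cases: "c \<in> {-1, 1}"
  proof (cases "\<exists>P\<in>field_orderings - T. position A P = A")
    case True
    then show ?thesis using c f by blast
  qed (auto simp: c_def)
  \<comment> \<open>Carries the value just below b across b, so that g no longer jumps at b and
    depends on the cuts in A only.\<close>
  define g where "g = (\<lambda>P\<in>field_orderings. if P \<in> T then c else f P)"
  have "g \<in> field_sign_group"
  proof (rule insert.IH)
    show "g \<in> field_orderings \<rightarrow>\<^sub>E {-1, 1}"
      using f c_cases by (auto simp: g_def PiE_iff)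
    show "blockwise (position A) field_orderings g"
      unfolding blockwise_def
    proof (intro ballI impI)
      fix P P' :: "rational_function set"
      assume P: "P \<in> field_orderings" "P' \<in> field_orderings" "position A P = position A P'"
      consider "P \<in> T" "P' \<in> T" | "P \<in> T" "P' \<notin> T" | "P \<notin> T" "P' \<in> T" | "P \<notin> T" "P' \<notin> T" by blast
      then show "g P = g P'"
      proof cases
        case 1
        then show ?thesis using P by (simp add: g_def)
      next
        case 2
        then show ?thesis using P top[of P] c[of P'] by (simp add: g_def)
      next
        case 3
        then show ?thesis using P top[of P'] c[of P] by (simp add: g_def)
      next
        case 4
        then have "f P = f P'" using P pos by (intro blockwiseD[OF insert.prems(2)]) auto
        then show ?thesis using P 4 by (simp add: g_def)
      qed
    qed
  qed
  show ?case
  proof (cases "\<exists>P\<in>T. f P \<noteq> c")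
    case False
    then have "f = g" using insert.prems(1)
      by (intro extensionalityI[of _ field_orderings]) (auto simp: g_def PiE_iff)
    then show ?thesis using \<open>g \<in> field_sign_group\<close> by simp
  next
    case True
    then obtain R where R: "R \<in> T" "f R \<noteq> c" by blast
    have fT: "f P = - c" if P: "P \<in> T" for P
    proof -
      have "P \<in> field_orderings" "R \<in> field_orderings" using P R by (auto simp: T_def)
      then have "f P = f R" "f R \<in> {-1, 1}"
        using pos P R f by (auto intro: blockwiseD[OF insert.prems(2)])
      then show ?thesis using R(2) c_cases by auto
    qed
    \<comment> \<open>The sign of b - x rather than x - b: it is 1 below b, where f and g already
      agree.\<close>
    let ?t = "restrict (poly_sign [:b, -1:]) field_orderings"
    have t: "poly_sign [:b, -1:] P = (if P \<in> T then -1 else 1)" if P: "P \<in> field_orderings" for P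
    proof -
      have "poly_sign [:b, -1:] P = - poly_sign [:- b, 1:] P"
        using ordering_sign_minus[OF P, of "to_fract [:- b, 1:]"]
        by (simp add: poly_sign_def flip: to_fract_uminus)
      then show ?thesis using P by (simp add: poly_sign_def ordering_sign_def T_def cone_of_def)
    qed
    have "f = (\<lambda>P\<in>field_orderings. g P * ?t P)"
    proof (rule extensionalityI[of _ field_orderings])
      show "f \<in> extensional field_orderings" using insert.prems(1) by (simp add: PiE_iff)
      show "f P = (\<lambda>P\<in>field_orderings. g P * ?t P) P" if "P \<in> field_orderings" for P
        using that t fT by (simp add: g_def)
    qed simp
    moreover have "?t \<in> field_sign_group" by (rule poly_sign_in_field_sign_group) simp
    ultimately show ?thesis
      using field_sign_group_mult[OF \<open>g \<in> field_sign_group\<close>, of ?t] by metis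
  qed
qed

text \<open>Multiplying f by the sign of the prime product F leaves a function of the position
  alone, and both factors are signs of field elements.\<close>

lemma admissible_group_subset:
  assumes "admissible S Q"
  shows "admissible_group S Q \<subseteq> field_sign_group"
proof
  fix f assume "f \<in> admissible_group S Q"
  then obtain e :: "rat poly \<Rightarrow> nat" where f: "f \<in> field_orderings \<rightarrow>\<^sub>E {-1, 1}"
    and e: "blockwise (position Q) field_orderings (\<lambda>P. f P * (\<Prod>p\<in>S. poly_sign p P ^ e p))"
    by (auto simp: block_group_def)
  have S: "finite S" "\<And>p. p \<in> S \<Longrightarrow> p \<noteq> 0" "finite Q" using assms by (auto simp: admissible_def)
  define F where "F = (\<Prod>p\<in>S. p ^ e p)"
  have F0: "F \<noteq> 0" using S by (simp add: F_def)
  have to_fract_F: "to_fract F = (\<Prod>p\<in>S. to_fract p ^ e p)"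
  proof -
    have "to_fract (p ^ n) = to_fract p ^ n" for p :: "rat poly" and n by (induction n) simp_all
    moreover have "to_fract (\<Prod>p\<in>S. g p) = (\<Prod>p\<in>S. to_fract (g p))" for g :: "rat poly \<Rightarrow> rat poly"
      by (induction S rule: infinite_finite_induct) simp_all
    ultimately show ?thesis by (simp add: F_def)
  qed
  have F: "poly_sign F P = (\<Prod>p\<in>S. poly_sign p P ^ e p)" if "P \<in> field_orderings" for P
    using ordering_sign_prod_power[OF that S(1), of to_fract e] S(2) by (simp add: poly_sign_def to_fract_F)
  define u where "u = (\<lambda>P\<in>field_orderings. f P * poly_sign F P)"
  have "u \<in> field_sign_group"
  proof (rule blockwise_in_field_sign_group[OF S(3)])
    have "f P * poly_sign F P \<in> {-1, 1}" if "P \<in> field_orderings" for P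
      using PiE_mem[OF f that] by (auto simp: poly_sign_def ordering_sign_def)
    then show "u \<in> field_orderings \<rightarrow>\<^sub>E {-1, 1}" by (auto simp: u_def)
    have "u P = f P * (\<Prod>p\<in>S. poly_sign p P ^ e p)" if "P \<in> field_orderings" for P
      using that F[OF that] by (simp add: u_def)
    then have "u P = u P'" if "P \<in> field_orderings" "P' \<in> field_orderings" "position Q P = position Q P'" for P P'
      using blockwiseD[OF e that] that by simp
    then show "blockwise (position Q) field_orderings u"
      unfolding blockwise_def by blast
  qed
  then have "(\<lambda>P\<in>field_orderings. u P * restrict (poly_sign F) field_orderings P) \<in> field_sign_group"
    using poly_sign_in_field_sign_group[OF F0] by (rule field_sign_group_mult)
  moreover have "(\<lambda>P\<in>field_orderings. u P * restrict (poly_sign F) field_orderings P) = f"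
    using f by (intro extensionalityI[of _ field_orderings])
      (auto simp: u_def PiE_iff poly_sign_def ordering_sign_def)
  ultimately show "f \<in> field_sign_group" by simp
qed

section \<open>Exhausting the sign group by finite groups\<close>

definition admissible_groups :: "(rational_function set \<Rightarrow> int) set set" where
  "admissible_groups = {admissible_group S Q | S Q. admissible S Q}"

text \<open>Uniting two admissible pairs is not enough: a prime of S and one of S' may both change
  sign on a block, so the cuts are refined further.\<close>

lemma admissible_groups_directed:
  assumes "H \<in> admissible_groups" "K \<in> admissible_groups"
  shows "\<exists>L\<in>admissible_groups. H \<union> K \<subseteq> L"
proof -
  obtain S Q S' Q' where SQ: "admissible S Q" "admissible S' Q'"
    "H = admissible_group S Q" "K = admissible_group S' Q'"
    using assms by (auto simp: admissible_groups_def)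
  then have "finite (S \<union> S')" "\<And>p. p \<in> S \<union> S' \<Longrightarrow> prime p" "finite (Q \<union> Q')"
    by (auto simp: admissible_def)
  then obtain R where R: "Q \<union> Q' \<subseteq> R" "admissible (S \<union> S') R" by (rule admissible_extend)
  then have "H \<subseteq> admissible_group (S \<union> S') R" "K \<subseteq> admissible_group (S \<union> S') R"
    unfolding SQ using R(1) \<open>finite (S \<union> S')\<close> by (intro admissible_group_mono; blast)+
  then show ?thesis using R(2) unfolding admissible_groups_def by blast
qed

text \<open>Induction over the prime factorisation. Constants have the same sign in every ordering;
  a single prime is admissible without cuts because separation concerns pairs; directedness supplies
  one group that contains both factors.\<close>

lemma poly_sign_in_admissible_groups:
  assumes "f \<noteq> 0"
  shows "restrict (poly_sign f) field_orderings \<in> \<Union>admissible_groups"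
  using assms
proof (induction f rule: prime_divisors_induct)
  case (unit f)
  then obtain c where c: "f = [:c:]" "c \<noteq> 0"
    by (metis is_unit_polyE is_unit_pCons_iff)
  have "poly_sign f P = poly_sign f P'" if P: "P \<in> field_orderings" "P' \<in> field_orderings" for P P'
  proof (cases "c > 0")
    case True
    then show ?thesis using ordering_nonneg_const[of _ c] P c by (simp add: poly_sign_def ordering_sign_def)
  next
    case False
    then have "poly_sign (- f) P = poly_sign (- f) P'"
      using ordering_nonneg_const[of _ "- c"] P c by (simp add: poly_sign_def ordering_sign_def)
    then show ?thesis using ordering_sign_minus[OF P(1), of "to_fract f"] ordering_sign_minus[OF P(2), of "to_fract f"] c
      by (simp add: poly_sign_def flip: to_fract_uminus)
  qed
  then have const: "blockwise (position {}) field_orderings (restrict (poly_sign f) field_orderings)"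
    unfolding blockwise_def by (metis restrict_apply')
  have admissible: "admissible {} {}" by (simp add: admissible_def)
  have "restrict (poly_sign f) field_orderings \<in> admissible_group {} {}"
    by (rule block_space.blockwise_in_block_group[OF block_space_admissible[OF admissible] _ const])
      (simp add: poly_sign_def ordering_sign_def PiE_iff)
  with admissible show ?case unfolding admissible_groups_def by blast
next
  case (factor p f)
  then have f0: "f \<noteq> 0" "p \<noteq> 0" by auto
  then have f: "restrict (poly_sign f) field_orderings \<in> \<Union>admissible_groups" by (intro factor.IH)
  have p: "admissible {p} {}" using factor.hyps by (simp add: admissible_def)
  interpret p: block_space field_orderings "position {}" "{p}" poly_sign
    by (rule block_space_admissible[OF p])
  have "restrict (poly_sign p) field_orderings \<in> admissible_group {p} {}"
    using p.generator_in_block_group[of p] by simp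
  then obtain H where H: "H \<in> admissible_groups" "restrict (poly_sign p) field_orderings \<in> H"
    using p unfolding admissible_groups_def by blast
  obtain K where K: "K \<in> admissible_groups" "restrict (poly_sign f) field_orderings \<in> K" using f by blast
  obtain L where L: "L \<in> admissible_groups" "H \<union> K \<subseteq> L" using admissible_groups_directed[OF H(1) K(1)] by blast
  then obtain S Q where SQ: "admissible S Q" "L = admissible_group S Q" by (auto simp: admissible_groups_def)
  have "(\<lambda>P\<in>field_orderings. restrict (poly_sign p) field_orderings P * restrict (poly_sign f) field_orderings P) \<in> L"
    unfolding SQ(2) by (rule block_space.mult_block_group[OF block_space_admissible[OF SQ(1)]])
      (use H K L SQ in blast)+
  moreover have "(\<lambda>P\<in>field_orderings. restrict (poly_sign p) field_orderings P * restrict (poly_sign f) field_orderings P) =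
      restrict (poly_sign (p * f)) field_orderings"
    using f0 by (auto simp: poly_sign_def ordering_sign_mult)
  ultimately have "restrict (poly_sign (p * f)) field_orderings \<in> L" by (simp only:)
  with L(1) show ?case by blast
qed simp

lemma Union_admissible_groups: "\<Union>admissible_groups = field_sign_group"
proof
  show "\<Union>admissible_groups \<subseteq> field_sign_group"
    using admissible_group_subset unfolding admissible_groups_def by blast
  show "field_sign_group \<subseteq> \<Union>admissible_groups"
  proof
    fix s :: "rational_function set \<Rightarrow> int" assume "s \<in> field_sign_group"
    then obtain a where a: "a \<noteq> 0" "s = restrict (ordering_sign a) field_orderings"
      by (auto simp: field_sign_group_ordering_sign)
    obtain n d where nd: "a = Fract n d" "d \<noteq> 0" "n \<noteq> 0"
      using a(1) by (cases a rule: Fract_cases_nonzero) auto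
    \<comment> \<open>The fraction n / d and the product n d differ by the square of d, so they have
      the same sign in every ordering.\<close>
    have an: "to_fract (n * d) = a * (to_fract d * to_fract d)"
      using nd by (simp add: Fract_conv_to_fract)
    have "ordering_sign a P = poly_sign (n * d) P" if P: "P \<in> field_orderings" for P
      unfolding poly_sign_def an
      using ordering_sign_mult[OF P a(1), of "to_fract d * to_fract d"] nd(2) ordering_square[OF P, of "to_fract d"]
      by (simp add: ordering_sign_def[of "to_fract d * to_fract d"])
    then have "s = restrict (poly_sign (n * d)) field_orderings" using a(2) by auto
    moreover have "n * d \<noteq> 0" using nd by simp
    ultimately show "s \<in> \<Union>admissible_groups" using poly_sign_in_admissible_groups by metis
  qed
qed

theorem theorem1:
  shows "profinite (field_orderings :: rat poly fract set set) field_sign_group"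
proof -
  have prespace: "sign_prespace field_orderings H" "finite H" if "H \<in> admissible_groups" for H
    using that block_space.sign_prespace_block_group[OF block_space_admissible]
      block_space.finite_block_group[OF block_space_admissible]
    by (auto simp: admissible_groups_def)
  have "sign_prespace field_orderings (\<Union>admissible_groups)"
  proof (rule sign_prespace_directed_Union)
    show "admissible_groups \<noteq> {}"
      unfolding admissible_groups_def by (auto simp: admissible_def intro!: exI[of _ "{}"])
    show "\<exists>P\<in>field_orderings. \<forall>a\<in>\<Union>admissible_groups. \<chi> a = a P"
      if "\<chi> \<in> \<Union>admissible_groups \<rightarrow> {-1, 1}"
        "\<And>a b. \<lbrakk>a \<in> \<Union>admissible_groups; b \<in> \<Union>admissible_groups\<rbrakk> \<Longrightarrow>
          \<chi> (\<lambda>P\<in>field_orderings. a P * b P) = \<chi> a * \<chi> b"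
        "\<chi> (\<lambda>P\<in>field_orderings. -1) = -1"
        "\<And>a b c. \<lbrakk>a \<in> \<Union>admissible_groups; b \<in> \<Union>admissible_groups; \<chi> a = 1; \<chi> b = 1;
          c \<in> value_set field_orderings (\<Union>admissible_groups) a b\<rbrakk> \<Longrightarrow> \<chi> c = 1" for \<chi>
      using that unfolding Union_admissible_groups by (rule field_characters)
  qed (fact admissible_groups_directed prespace(1))+
  then have "space_of_orderings (field_orderings :: rational_function set set) field_sign_group"
    unfolding Union_admissible_groups
    by (rule sign_prespace.space_of_orderings) (rule field_sign_group_separates)
  then show ?thesis
    by (rule space_of_orderings.profiniteI[OF _ Union_admissible_groups admissible_groups_directed prespace(2,1)])
qed

end
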